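(* Let $M$ be a manifold with a harmonic almost contact metric structure (notation as in the context) of one of the following types, where $x=11$ or $x=12$: $\mathcal C_1\oplus\mathcal C_2\oplus\mathcal C_5\oplus\mathcal C_6\oplus\mathcal C_7\oplus\mathcal C_8\oplus\mathcal C_x$; or $\mathcal C_3\oplus\mathcal C_4\oplus\mathcal C_9\oplus\mathcal C_{10}\oplus\mathcal C_x$; or $\mathcal C_1\oplus\mathcal C_5\oplus\mathcal C_6\oplus\mathcal C_7\oplus\mathcal C_8\oplus\mathcal C_9\oplus\mathcal C_x$; or $\mathcal C_1\oplus\mathcal C_2\oplus\mathcal C_3\oplus\mathcal C_4\oplus\mathcal C_x$; or $\mathcal C_3\oplus\mathcal C_5\oplus\mathcal C_6\oplus\mathcal C_x$. Then the Reeb vector field $\zeta$ is harmonic as a unit vector field.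
   Context: SETUP. An almost contact metric manifold of dimension $2n+1$ is a Riemannian manifold $(M,\langle\cdot,\cdot\rangle)$ (Levi-Civita connection $\nabla$) with a $(1,1)$-tensor field $\varphi$ and a unit vector field $\zeta$ (Reeb vector field) such that $\varphi^2=-I+\eta\otimes\zeta$, $\langle\varphi X,\varphi Y\rangle=\langle X,Y\rangle-\eta(X)\eta(Y)$, where $\eta=\langle\zeta,\cdot\rangle$. $F(X,Y)=\langle X,\varphi Y\rangle$; $\{e_1,\dots,e_{2n},e_{2n+1}=\zeta\}$ is a local orthonormal frame, repeated indices are summed from $1$ to $2n+1$. INTRINSIC TORSION. $\xi_XY=\tfrac12(\nabla_X\varphi)\varphi Y+\tfrac12(\nabla_X\eta)(Y)\zeta-\eta(Y)\nabla_X\zeta$; each $\xi_X$ is skew-symmetric. CLASSES. $\xi=\sum_{i=1}^{12}\xi_{(i)}$ uniquely with $\xi_{(i)}$ in the pointwise subspace $\mathcal C_i$ of tensors $\tau$ ($\tau_X$ skew) given as follows ($X,Y,Z\perp\zeta$). $\mathcal C_1,\dots,\mathcal C_4$: $\tau_\zeta=0$, $\tau_X\zeta=0$, $\tau_X\varphi Y=-\varphi\tau_XY$, and: $\mathcal C_1$: $\tau_XY=-\tau_YX$; $\mathcal C_2$: $\tau_{\varphi X}\varphi Y=-\tau_XY$ and the cyclic sum of $\langle\tau_XY,Z\rangle$ vanishes; $\mathcal C_3$: $\tau_{\varphi X}\varphi Y=\tau_XY$ and $\tau_{e_i}e_i=0$; $\mathcal C_4$: $4\tau_XY=\langle X,Y\rangle\theta^\sharp-\theta(Y)X-\langle\varphi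 X,Y\rangle\varphi\theta^\sharp+\langle\varphi\theta^\sharp,Y\rangle\varphi X$ for some one-form $\theta$ with $\theta(\zeta)=0$ and metric dual $\theta^\sharp$. $\mathcal C_5,\dots,\mathcal C_{10}$: $\tau_\zeta=0$, $\langle\tau_XY,Z\rangle=0$, and $\beta(X,Y)=\langle\tau_X\zeta,Y\rangle$ on $\zeta^\perp$ is: $\mathcal C_5$: a multiple of $\langle\cdot,\cdot\rangle$; $\mathcal C_6$: a multiple of $F$; $\mathcal C_7$: skew, $\beta(\varphi X,\varphi Y)=\beta(X,Y)$, orthogonal to $F$; $\mathcal C_8$: symmetric, trace-free, $\beta(\varphi X,\varphi Y)=\beta(X,Y)$; $\mathcal C_9$: symmetric, $\beta(\varphi X,\varphi Y)=-\beta(X,Y)$; $\mathcal C_{10}$: skew, $\beta(\varphi X,\varphi Y)=-\beta(X,Y)$. $\mathcal C_{11}$: $\tau_X=0$, $\tau_\zeta\zeta=0$, $\tau_\zeta\varphi=-\varphi\tau_\zeta$. $\mathcal C_{12}$: $\tau_X=0$, $\langle\tau_\zeta X,Y\rangle=0$. The structure is of type $\mathcal C_{i_1}\oplus\dots\oplus\mathcal C_{i_k}$ if $\xi_{(j)}=0$ for all $j\notin\{i_1,\dots,i_k\}$. HARMONICITY. The structure is harmonic if $d^*\xi=-(\nabla_{e_i}\xi)_{e_i}=0$. A unit vector field $\zeta$ is a harmonic unit vector field if $\nabla^*\nabla\zeta=\|\nabla\zeta\|^2\zeta$, where $\nabla^*\nabla\zeta=-(\nabla^2\zeta)_{e_i,e_i}$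 with $(\nabla^2\zeta)_{X,Y}=\nabla_X(\nabla_Y\zeta)-\nabla_{\nabla_XY}\zeta$, and $\|\nabla\zeta\|^2=\langle\nabla_{e_i}\zeta,\nabla_{e_i}\zeta\rangle$. *)

theory Defs
  imports "HOL-Analysis.Analysis"
begin

section \<open>Smooth maps between Euclidean spaces\<close>

text \<open>Meant for open \<open>S\<close>: all partial derivatives up to order \<open>k\<close> exist and are continuous on \<open>S\<close>.\<close>

primrec Ck_on :: "nat \<Rightarrow> 'e::euclidean_space set \<Rightarrow> ('e \<Rightarrow> 'b::real_normed_vector) \<Rightarrow> bool" where
  "Ck_on 0 S f \<longleftrightarrow> continuous_on S f"
| "Ck_on (Suc k) S f \<longleftrightarrow>
     (\<forall>y\<in>S. f differentiable (at y)) \<and> (\<forall>b\<in>Basis. Ck_on k S (\<lambda>y. frechet_derivative f (at y) b))"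

definition smooth_on :: "'e::euclidean_space set \<Rightarrow> ('e \<Rightarrow> 'b::real_normed_vector) \<Rightarrow> bool" where
  "smooth_on S f \<longleftrightarrow> (\<forall>k. Ck_on k S f)"


section \<open>Smooth manifolds\<close>

text \<open>
  The smooth structure on the topological space \<open>M\<close> is given by an atlas indexed by the points
  of \<open>M\<close>: the chart \<open>x p : U p \<rightarrow> 'e\<close> is a chart around \<open>p\<close>. (Every smooth structure has such an
  atlas: choose a chart around each point.)

  The tangent space at \<open>q\<close> is represented by the model space \<open>'e\<close>: the vector \<open>v :: 'e\<close> stands for
  the tangent vector at \<open>q\<close> whose components in the preferred chart \<open>x q\<close> are \<open>v\<close>. Its
  components in another chart \<open>x p\<close> are \<open>coords p q v\<close>. The inner product and the norm that \<open>'e\<close>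
  carries as a Euclidean space have no geometric meaning on tangent vectors.

  Vector fields and functions on an open set \<open>W\<close> are total functions on \<open>'a\<close> of which only the
  values on \<open>W\<close> matter.
\<close>

locale smooth_manifold =
  fixes M :: "'a topology"
    and U :: "'a \<Rightarrow> 'a set"
    and x :: "'a \<Rightarrow> 'a \<Rightarrow> 'e::euclidean_space"
  assumes Hausdorff: "Hausdorff_space M"
    and second_countable: "second_countable M"
    and chart_domain: "p \<in> topspace M \<Longrightarrow> openin M (U p) \<and> p \<in> U p"
    and chart_image: "p \<in> topspace M \<Longrightarrow> open (x p ` U p)"
    and chart_homeo: "p \<in> topspace M \<Longrightarrow>
           homeomorphic_map (subtopology M (U p)) (top_of_set (x p ` U p)) (x p)"
    and transition_smooth: "p \<in> topspace M \<Longrightarrow> q \<in> topspace M \<Longrightarrow>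
           smooth_on (x p ` (U p \<inter> U q)) (x q \<circ> inv_into (U p) (x p))"
begin

definition smooth_fun :: "'a set \<Rightarrow> ('a \<Rightarrow> real) \<Rightarrow> bool" where
  "smooth_fun W f \<longleftrightarrow>
     (\<forall>p\<in>topspace M. smooth_on (x p ` (U p \<inter> W)) (f \<circ> inv_into (U p) (x p)))"

definition coords :: "'a \<Rightarrow> 'a \<Rightarrow> 'e \<Rightarrow> 'e" where
  "coords p q v = frechet_derivative (x p \<circ> inv_into (U q) (x q)) (at (x q q)) v"

definition smooth_field :: "'a set \<Rightarrow> ('a \<Rightarrow> 'e) \<Rightarrow> bool" where
  "smooth_field W X \<longleftrightarrow>
     (\<forall>p\<in>topspace M. smooth_on (x p ` (U p \<inter> W))
        ((\<lambda>q. coords p q (X q)) \<circ> inv_into (U p) (x p)))"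

text \<open>The function \<open>X f\<close>, i.e. the derivative of \<open>f\<close> along the vector field \<open>X\<close>.\<close>

definition lie_deriv :: "('a \<Rightarrow> 'e) \<Rightarrow> ('a \<Rightarrow> real) \<Rightarrow> 'a \<Rightarrow> real" where
  "lie_deriv X f p = frechet_derivative (f \<circ> inv_into (U p) (x p)) (at (x p p)) (X p)"

end


section \<open>Riemannian manifolds\<close>

text \<open>
  \<open>nab X Y\<close> is the covariant derivative of \<open>Y\<close> along \<open>X\<close> for vector fields that are smooth on an
  open set \<open>W\<close>; being a torsion-free metric connection characterises it uniquely on \<open>W\<close>. In
  \<open>nab_torsion_free\<close> the Lie bracket of \<open>X\<close> and \<open>Y\<close> is written through its action on functions.
\<close>

locale riemannian_manifold = smooth_manifold M U x
  for M :: "'a topology" and U :: "'a \<Rightarrow> 'a set" and x :: "'a \<Rightarrow> 'a \<Rightarrow> 'e::euclidean_space" +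
  fixes g :: "'a \<Rightarrow> 'e \<Rightarrow> 'e \<Rightarrow> real"
    and nab :: "('a \<Rightarrow> 'e) \<Rightarrow> ('a \<Rightarrow> 'e) \<Rightarrow> 'a \<Rightarrow> 'e"
  assumes metric_bilinear: "p \<in> topspace M \<Longrightarrow> bilinear (g p)"
    and metric_sym: "p \<in> topspace M \<Longrightarrow> g p v w = g p w v"
    and metric_pos: "p \<in> topspace M \<Longrightarrow> v \<noteq> 0 \<Longrightarrow> g p v v > 0"
    and metric_smooth: "openin M W \<Longrightarrow> smooth_field W X \<Longrightarrow> smooth_field W Y \<Longrightarrow>
           smooth_fun W (\<lambda>p. g p (X p) (Y p))"
    and nab_smooth: "openin M W \<Longrightarrow> smooth_field W X \<Longrightarrow> smooth_field W Y \<Longrightarrow>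
           smooth_field W (nab X Y)"
    and nab_add_left: "openin M W \<Longrightarrow> smooth_field W X \<Longrightarrow> smooth_field W X' \<Longrightarrow> smooth_field W Y \<Longrightarrow>
           p \<in> W \<Longrightarrow> nab (\<lambda>q. X q + X' q) Y p = nab X Y p + nab X' Y p"
    and nab_scale_left: "openin M W \<Longrightarrow> smooth_fun W f \<Longrightarrow> smooth_field W X \<Longrightarrow> smooth_field W Y \<Longrightarrow>
           p \<in> W \<Longrightarrow> nab (\<lambda>q. f q *\<^sub>R X q) Y p = f p *\<^sub>R nab X Y p"
    and nab_add_right: "openin M W \<Longrightarrow> smooth_field W X \<Longrightarrow> smooth_field W Y \<Longrightarrow> smooth_field W Y' \<Longrightarrow>
           p \<in> W \<Longrightarrow> nab X (\<lambda>q. Y q + Y' q) p = nab X Y p + nab X Y' p"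
    and nab_leibniz: "openin M W \<Longrightarrow> smooth_fun W f \<Longrightarrow> smooth_field W X \<Longrightarrow> smooth_field W Y \<Longrightarrow>
           p \<in> W \<Longrightarrow> nab X (\<lambda>q. f q *\<^sub>R Y q) p = lie_deriv X f p *\<^sub>R Y p + f p *\<^sub>R nab X Y p"
    and nab_metric: "openin M W \<Longrightarrow> smooth_field W X \<Longrightarrow> smooth_field W Y \<Longrightarrow> smooth_field W Z \<Longrightarrow>
           p \<in> W \<Longrightarrow> lie_deriv X (\<lambda>q. g q (Y q) (Z q)) p =
             g p (nab X Y p) (Z p) + g p (Y p) (nab X Z p)"
    and nab_torsion_free: "openin M W \<Longrightarrow> smooth_fun W f \<Longrightarrow> smooth_field W X \<Longrightarrow> smooth_field W Y \<Longrightarrow>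
           p \<in> W \<Longrightarrow> lie_deriv (nab X Y) f p - lie_deriv (nab Y X) f p =
             lie_deriv X (lie_deriv Y f) p - lie_deriv Y (lie_deriv X f) p"
begin

definition orthonormal_basis :: "'a \<Rightarrow> (nat \<Rightarrow> 'e) \<Rightarrow> bool" where
  "orthonormal_basis p e \<longleftrightarrow>
     (\<forall>i\<in>{1..DIM('e)}. \<forall>j\<in>{1..DIM('e)}. g p (e i) (e j) = (if i = j then 1 else 0))"

definition orthonormal_frame :: "'a set \<Rightarrow> (nat \<Rightarrow> 'a \<Rightarrow> 'e) \<Rightarrow> bool" where
  "orthonormal_frame W e \<longleftrightarrow>
     openin M W \<and> (\<forall>i\<in>{1..DIM('e)}. smooth_field W (e i)) \<and>
     (\<forall>p\<in>W. orthonormal_basis p (\<lambda>i. e i p))"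

definition second_nab :: "('a \<Rightarrow> 'e) \<Rightarrow> ('a \<Rightarrow> 'e) \<Rightarrow> ('a \<Rightarrow> 'e) \<Rightarrow> 'a \<Rightarrow> 'e" where
  "second_nab X Y V p = nab X (nab Y V) p - nab (nab X Y) V p"

text \<open>The rough Laplacian of \<open>V\<close> and the squared norm of its covariant derivative, in a frame \<open>e\<close>.\<close>

definition rough_laplacian :: "(nat \<Rightarrow> 'a \<Rightarrow> 'e) \<Rightarrow> ('a \<Rightarrow> 'e) \<Rightarrow> 'a \<Rightarrow> 'e" where
  "rough_laplacian e V p = - (\<Sum>i = 1..DIM('e). second_nab (e i) (e i) V p)"

definition nab_norm_sq :: "(nat \<Rightarrow> 'a \<Rightarrow> 'e) \<Rightarrow> ('a \<Rightarrow> 'e) \<Rightarrow> 'a \<Rightarrow> real" where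
  "nab_norm_sq e V p = (\<Sum>i = 1..DIM('e). g p (nab (e i) V p) (nab (e i) V p))"

text \<open>
  Traces do not depend on the orthonormal frame, and smooth orthonormal frames exist around every
  point; equations between traces are required in all local orthonormal frames.
\<close>

definition harmonic_unit_vector_field :: "('a \<Rightarrow> 'e) \<Rightarrow> bool" where
  "harmonic_unit_vector_field V \<longleftrightarrow>
     smooth_field (topspace M) V \<and> (\<forall>p\<in>topspace M. g p (V p) (V p) = 1) \<and>
     (\<forall>W e. orthonormal_frame W e \<longrightarrow>
        (\<forall>p\<in>W. rough_laplacian e V p = nab_norm_sq e V p *\<^sub>R V p))"

end


section \<open>Almost contact metric manifolds\<close>

locale almost_contact_metric_manifold = riemannian_manifold M U x g nab
  for M :: "'a topology" and U :: "'a \<Rightarrow> 'a set" and x :: "'a \<Rightarrow> 'a \<Rightarrow> 'e::euclidean_space"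
    and g :: "'a \<Rightarrow> 'e \<Rightarrow> 'e \<Rightarrow> real" and nab :: "('a \<Rightarrow> 'e) \<Rightarrow> ('a \<Rightarrow> 'e) \<Rightarrow> 'a \<Rightarrow> 'e" +
  fixes n :: nat
    and phi :: "'a \<Rightarrow> 'e \<Rightarrow> 'e"
    and zeta :: "'a \<Rightarrow> 'e"
  assumes dim: "DIM('e) = 2 * n + 1"
    and phi_linear: "p \<in> topspace M \<Longrightarrow> linear (phi p)"
    and phi_smooth: "openin M W \<Longrightarrow> smooth_field W X \<Longrightarrow> smooth_field W (\<lambda>p. phi p (X p))"
    and zeta_smooth: "smooth_field (topspace M) zeta"
    and zeta_unit: "p \<in> topspace M \<Longrightarrow> g p (zeta p) (zeta p) = 1"
    and phi_phi: "p \<in> topspace M \<Longrightarrow> phi p (phi p v) = - v + g p (zeta p) v *\<^sub>R zeta p"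
    and phi_metric: "p \<in> topspace M \<Longrightarrow>
           g p (phi p v) (phi p w) = g p v w - g p (zeta p) v * g p (zeta p) w"
begin

definition eta :: "'a \<Rightarrow> 'e \<Rightarrow> real" where
  "eta p v = g p (zeta p) v"

definition fundamental_form :: "'a \<Rightarrow> 'e \<Rightarrow> 'e \<Rightarrow> real" where
  "fundamental_form p v w = g p v (phi p w)"

definition phi_field :: "('a \<Rightarrow> 'e) \<Rightarrow> 'a \<Rightarrow> 'e" where
  "phi_field X p = phi p (X p)"

definition nab_phi :: "('a \<Rightarrow> 'e) \<Rightarrow> ('a \<Rightarrow> 'e) \<Rightarrow> 'a \<Rightarrow> 'e" where
  "nab_phi X Y p = nab X (phi_field Y) p - phi p (nab X Y p)"

definition nab_eta :: "('a \<Rightarrow> 'e) \<Rightarrow> ('a \<Rightarrow> 'e) \<Rightarrow> 'a \<Rightarrow> real" where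
  "nab_eta X Y p = lie_deriv X (\<lambda>q. eta q (Y q)) p - eta p (nab X Y p)"

text \<open>The intrinsic torsion, as an operator on local vector fields, and its covariant derivative:
  \<open>nab_xi Z X Y\<close> is \<open>(\<nabla>\<^sub>Z \<xi>)\<^sub>X Y\<close>.\<close>

definition xi :: "('a \<Rightarrow> 'e) \<Rightarrow> ('a \<Rightarrow> 'e) \<Rightarrow> 'a \<Rightarrow> 'e" where
  "xi X Y p = (1/2) *\<^sub>R nab_phi X (phi_field Y) p + ((1/2) * nab_eta X Y p) *\<^sub>R zeta p
              - eta p (Y p) *\<^sub>R nab X zeta p"

definition nab_xi :: "('a \<Rightarrow> 'e) \<Rightarrow> ('a \<Rightarrow> 'e) \<Rightarrow> ('a \<Rightarrow> 'e) \<Rightarrow> 'a \<Rightarrow> 'e" where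
  "nab_xi Z X Y p = nab Z (xi X Y) p - xi (nab Z X) Y p - xi X (nab Z Y) p"

text \<open>The endomorphism \<open>d\<^sup>*\<xi>\<close>, computed in a frame \<open>e\<close> and applied to \<open>Y\<close>.\<close>

definition codiff_xi :: "(nat \<Rightarrow> 'a \<Rightarrow> 'e) \<Rightarrow> ('a \<Rightarrow> 'e) \<Rightarrow> 'a \<Rightarrow> 'e" where
  "codiff_xi e Y p = - (\<Sum>i = 1..DIM('e). nab_xi (e i) (e i) Y p)"

definition harmonic_structure :: bool where
  "harmonic_structure \<longleftrightarrow>
     (\<forall>W e Y. orthonormal_frame W e \<longrightarrow> smooth_field W Y \<longrightarrow> (\<forall>p\<in>W. codiff_xi e Y p = 0))"

subsection \<open>The pointwise torsion classes\<close>

text \<open>In what follows \<open>t v w\<close> stands for \<open>\<tau>\<^sub>v w\<close>, with \<open>v, w\<close> tangent vectors at \<open>p\<close>.\<close>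

definition torsion_tensor :: "'a \<Rightarrow> ('e \<Rightarrow> 'e \<Rightarrow> 'e) \<Rightarrow> bool" where
  "torsion_tensor p t \<longleftrightarrow> bilinear t \<and> (\<forall>u v w. g p (t u v) w = - g p v (t u w))"

definition hor :: "'a \<Rightarrow> 'e set" where
  "hor p = {v. g p (zeta p) v = 0}"

definition adapted_basis :: "'a \<Rightarrow> (nat \<Rightarrow> 'e) \<Rightarrow> bool" where
  "adapted_basis p e \<longleftrightarrow> orthonormal_basis p e \<and> e (2 * n + 1) = zeta p"

definition almost_hermitian_type :: "'a \<Rightarrow> ('e \<Rightarrow> 'e \<Rightarrow> 'e) \<Rightarrow> bool" where
  "almost_hermitian_type p t \<longleftrightarrow> torsion_tensor p t \<and> (\<forall>v. t (zeta p) v = 0) \<and>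
     (\<forall>v\<in>hor p. t v (zeta p) = 0) \<and>
     (\<forall>v\<in>hor p. \<forall>w\<in>hor p. t v (phi p w) = - phi p (t v w))"

definition C1 :: "'a \<Rightarrow> ('e \<Rightarrow> 'e \<Rightarrow> 'e) \<Rightarrow> bool" where
  "C1 p t \<longleftrightarrow> almost_hermitian_type p t \<and> (\<forall>v\<in>hor p. \<forall>w\<in>hor p. t v w = - t w v)"

definition C2 :: "'a \<Rightarrow> ('e \<Rightarrow> 'e \<Rightarrow> 'e) \<Rightarrow> bool" where
  "C2 p t \<longleftrightarrow> almost_hermitian_type p t \<and>
     (\<forall>v\<in>hor p. \<forall>w\<in>hor p. t (phi p v) (phi p w) = - t v w) \<and>
     (\<forall>u\<in>hor p. \<forall>v\<in>hor p. \<forall>w\<in>hor p. g p (t u v) w + g p (t v w) u + g p (t w u) v = 0)"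

definition C3 :: "'a \<Rightarrow> ('e \<Rightarrow> 'e \<Rightarrow> 'e) \<Rightarrow> bool" where
  "C3 p t \<longleftrightarrow> almost_hermitian_type p t \<and>
     (\<forall>v\<in>hor p. \<forall>w\<in>hor p. t (phi p v) (phi p w) = t v w) \<and>
     (\<forall>e. orthonormal_basis p e \<longrightarrow> (\<Sum>i = 1..2 * n + 1. t (e i) (e i)) = 0)"

text \<open>Here \<open>a\<close> is the metric dual of the one-form \<open>\<theta>\<close>.\<close>

definition C4 :: "'a \<Rightarrow> ('e \<Rightarrow> 'e \<Rightarrow> 'e) \<Rightarrow> bool" where
  "C4 p t \<longleftrightarrow> almost_hermitian_type p t \<and>
     (\<exists>\<theta> a. linear \<theta> \<and> \<theta> (zeta p) = 0 \<and> (\<forall>v. g p a v = \<theta> v) \<and>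
       (\<forall>v\<in>hor p. \<forall>w\<in>hor p.
          4 *\<^sub>R t v w = g p v w *\<^sub>R a - \<theta> w *\<^sub>R v - g p (phi p v) w *\<^sub>R phi p a
                       + g p (phi p a) w *\<^sub>R phi p v))"

definition zeta_derivative_type :: "'a \<Rightarrow> ('e \<Rightarrow> 'e \<Rightarrow> 'e) \<Rightarrow> bool" where
  "zeta_derivative_type p t \<longleftrightarrow> torsion_tensor p t \<and> (\<forall>v. t (zeta p) v = 0) \<and>
     (\<forall>u\<in>hor p. \<forall>v\<in>hor p. \<forall>w\<in>hor p. g p (t u v) w = 0)"

definition beta :: "'a \<Rightarrow> ('e \<Rightarrow> 'e \<Rightarrow> 'e) \<Rightarrow> 'e \<Rightarrow> 'e \<Rightarrow> real" where
  "beta p t v w = g p (t v (zeta p)) w"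

definition C5 :: "'a \<Rightarrow> ('e \<Rightarrow> 'e \<Rightarrow> 'e) \<Rightarrow> bool" where
  "C5 p t \<longleftrightarrow> zeta_derivative_type p t \<and>
     (\<exists>c. \<forall>v\<in>hor p. \<forall>w\<in>hor p. beta p t v w = c * g p v w)"

definition C6 :: "'a \<Rightarrow> ('e \<Rightarrow> 'e \<Rightarrow> 'e) \<Rightarrow> bool" where
  "C6 p t \<longleftrightarrow> zeta_derivative_type p t \<and>
     (\<exists>c. \<forall>v\<in>hor p. \<forall>w\<in>hor p. beta p t v w = c * fundamental_form p v w)"

definition C7 :: "'a \<Rightarrow> ('e \<Rightarrow> 'e \<Rightarrow> 'e) \<Rightarrow> bool" where
  "C7 p t \<longleftrightarrow> zeta_derivative_type p t \<and>
     (\<forall>v\<in>hor p. \<forall>w\<in>hor p. beta p t v w = - beta p t w v) \<and>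
     (\<forall>v\<in>hor p. \<forall>w\<in>hor p. beta p t (phi p v) (phi p w) = beta p t v w) \<and>
     (\<forall>e. adapted_basis p e \<longrightarrow>
        (\<Sum>i = 1..2 * n. \<Sum>j = 1..2 * n. beta p t (e i) (e j) * fundamental_form p (e i) (e j)) = 0)"

definition C8 :: "'a \<Rightarrow> ('e \<Rightarrow> 'e \<Rightarrow> 'e) \<Rightarrow> bool" where
  "C8 p t \<longleftrightarrow> zeta_derivative_type p t \<and>
     (\<forall>v\<in>hor p. \<forall>w\<in>hor p. beta p t v w = beta p t w v) \<and>
     (\<forall>e. adapted_basis p e \<longrightarrow> (\<Sum>i = 1..2 * n. beta p t (e i) (e i)) = 0) \<and>
     (\<forall>v\<in>hor p. \<forall>w\<in>hor p. beta p t (phi p v) (phi p w) = beta p t v w)"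

definition C9 :: "'a \<Rightarrow> ('e \<Rightarrow> 'e \<Rightarrow> 'e) \<Rightarrow> bool" where
  "C9 p t \<longleftrightarrow> zeta_derivative_type p t \<and>
     (\<forall>v\<in>hor p. \<forall>w\<in>hor p. beta p t v w = beta p t w v) \<and>
     (\<forall>v\<in>hor p. \<forall>w\<in>hor p. beta p t (phi p v) (phi p w) = - beta p t v w)"

definition C10 :: "'a \<Rightarrow> ('e \<Rightarrow> 'e \<Rightarrow> 'e) \<Rightarrow> bool" where
  "C10 p t \<longleftrightarrow> zeta_derivative_type p t \<and>
     (\<forall>v\<in>hor p. \<forall>w\<in>hor p. beta p t v w = - beta p t w v) \<and>
     (\<forall>v\<in>hor p. \<forall>w\<in>hor p. beta p t (phi p v) (phi p w) = - beta p t v w)"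

definition C11 :: "'a \<Rightarrow> ('e \<Rightarrow> 'e \<Rightarrow> 'e) \<Rightarrow> bool" where
  "C11 p t \<longleftrightarrow> torsion_tensor p t \<and> (\<forall>v\<in>hor p. \<forall>w. t v w = 0) \<and>
     t (zeta p) (zeta p) = 0 \<and> (\<forall>v. t (zeta p) (phi p v) = - phi p (t (zeta p) v))"

definition C12 :: "'a \<Rightarrow> ('e \<Rightarrow> 'e \<Rightarrow> 'e) \<Rightarrow> bool" where
  "C12 p t \<longleftrightarrow> torsion_tensor p t \<and> (\<forall>v\<in>hor p. \<forall>w. t v w = 0) \<and>
     (\<forall>v\<in>hor p. \<forall>w\<in>hor p. g p (t (zeta p) v) w = 0)"

definition torsion_class :: "nat \<Rightarrow> 'a \<Rightarrow> ('e \<Rightarrow> 'e \<Rightarrow> 'e) \<Rightarrow> bool" where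
  "torsion_class i = [C1, C2, C3, C4, C5, C6, C7, C8, C9, C10, C11, C12] ! (i - 1)"

text \<open>\<open>t i p\<close> is the value at \<open>p\<close> of the component of the intrinsic torsion in the \<open>i\<close>-th class.
  The structure is of type \<open>I\<close> if the components with index outside \<open>I\<close> vanish.\<close>

definition torsion_decomposition :: "(nat \<Rightarrow> 'a \<Rightarrow> 'e \<Rightarrow> 'e \<Rightarrow> 'e) \<Rightarrow> bool" where
  "torsion_decomposition t \<longleftrightarrow>
     (\<forall>i\<in>{1..12}. \<forall>p\<in>topspace M. torsion_class i p (t i p)) \<and>
     (\<forall>W X Y. openin M W \<longrightarrow> smooth_field W X \<longrightarrow> smooth_field W Y \<longrightarrow>
        (\<forall>p\<in>W. xi X Y p = (\<Sum>i = 1..12. t i p (X p) (Y p))))"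

definition structure_of_type :: "nat set \<Rightarrow> bool" where
  "structure_of_type I \<longleftrightarrow>
     (\<exists>t. torsion_decomposition t \<and>
          (\<forall>j\<in>{1..12} - I. \<forall>p\<in>topspace M. \<forall>v w. t j p v w = 0))"

end

end

theory Submission
  imports Defs
begin

text \<open>
  Since \<open>\<xi>\<^sub>X\<zeta> = - \<nabla>\<^sub>X\<zeta>\<close>, evaluating \<open>d\<^sup>*\<xi> = 0\<close> on \<open>\<zeta>\<close> turns the harmonicity of the structure into
  \<open>\<nabla>\<^sup>*\<nabla>\<zeta> = - \<xi>\<^sub>e \<xi>\<^sub>e \<zeta>\<close>, summed over an orthonormal frame \<open>e\<close> (\<open>rough_laplacian_zeta\<close>). The
  inner product of the right-hand side with \<open>w\<close> is the sum of \<open>\<langle>\<xi>\<^sub>e\<zeta>, \<xi>\<^sub>e w\<rangle>\<close>, because each \<open>\<xi>\<^sub>e\<close> is skew.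
  For \<open>w = \<zeta>\<close> this is \<open>\<parallel>\<nabla>\<zeta>\<parallel>\<^sup>2\<close>, so \<open>\<zeta>\<close> is a harmonic unit vector field as soon as the sum vanishes
  for all \<open>w\<close> orthogonal to \<open>\<zeta>\<close>. This is a condition at a single point.

  Expand \<open>\<xi>\<close> in both places into its components. The resulting mixed terms, the sums of
  \<open>\<langle>\<sigma>\<^sub>e\<zeta>, \<tau>\<^sub>e w\<rangle>\<close> with \<open>\<sigma>\<close> in the \<open>i\<close>-th and \<open>\<tau>\<close> in the \<open>j\<close>-th class, vanish for nearly all pairs of
  classes by the shape of the tensors alone. The exceptions are \<open>i = 12\<close>, \<open>j = 11\<close>, excluded because
  at most one of these two classes occurs, and \<open>5 \<le> i \<le> 10\<close>, \<open>1 \<le> j \<le> 4\<close>. In the latter case the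
  mixed term is, up to sign, the pairing of the bilinear forms \<open>\<beta>(u, v) = \<langle>\<sigma>\<^sub>u\<zeta>, v\<rangle>\<close> and
  \<open>\<langle>\<tau>\<^sub>u v, w\<rangle>\<close>. It vanishes

  \<^item> if one form is invariant under \<open>\<phi>\<close> and the other changes sign: \<open>i = 5, ..., 8\<close> with \<open>j = 1, 2\<close>,
    and \<open>i = 9, 10\<close> with \<open>j = 3, 4\<close> (\<open>mixed_term_phi_type\<close>);
  \<^item> if one is symmetric and the other skew: \<open>i = 9\<close>, \<open>j = 1\<close> (\<open>mixed_term_C9_C1\<close>);
  \<^item> for \<open>i = 5, 6\<close> and \<open>j = 3\<close>, where it only involves the vanishing trace \<open>\<tau>\<^sub>e e\<close>
    (\<open>mixed_term_C5_C6_C3\<close>).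

  The types in the theorem are such that only these pairs occur.
\<close>

section \<open>Smooth maps\<close>

lemma Ck_on_subset: "Ck_on k S f \<Longrightarrow> T \<subseteq> S \<Longrightarrow> Ck_on k T f"
proof (induction k arbitrary: f)
  case 0
  then show ?case by (auto intro: continuous_on_subset)
next
  case (Suc k)
  then show ?case by (simp add: subset_iff)
qed

lemma Ck_on_cong_open:
  assumes "open S" "\<And>y. y \<in> S \<Longrightarrow> f y = h y" "Ck_on k S f"
  shows "Ck_on k S h"
  using assms(2,3)
proof (induction k arbitrary: f h)
  case 0
  then show ?case using continuous_on_cong[of S S f h] by auto
next
  case (Suc k)
  have der: "(h has_derivative frechet_derivative f (at y)) (at y)" if "y \<in> S" for y
    using Suc.prems that frechet_derivative_works has_derivative_transform_within_open[OF _ assms(1) that]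
    by (metis Ck_on.simps(2))
  then have "frechet_derivative f (at y) = frechet_derivative h (at y)" if "y \<in> S" for y
    using that frechet_derivative_at by blast
  then have "Ck_on k S (\<lambda>y. frechet_derivative h (at y) b)" if "b \<in> Basis" for b
    using Suc.IH[of "\<lambda>y. frechet_derivative f (at y) b"] Suc.prems(2) that by simp
  with der show ?case unfolding Ck_on.simps differentiable_def by blast
qed

lemma Ck_on_const: "Ck_on k S (\<lambda>_. c)"
  by (induction k arbitrary: c) auto

lemma Ck_on_minus:
  assumes "open S" "Ck_on k S f"
  shows "Ck_on k S (\<lambda>y. - f y)"
  using assms(2)
proof (induction k arbitrary: f)
  case 0
  then show ?case by (simp add: continuous_on_minus)
next
  case (Suc k)
  have der: "((\<lambda>y. - f y) has_derivative (\<lambda>b. - frechet_derivative f (at y) b)) (at y)" if "y \<in> S" for y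
    using Suc.prems that by (simp add: frechet_derivative_works has_derivative_minus)
  then have *: "frechet_derivative (\<lambda>y. - f y) (at y) = (\<lambda>b. - frechet_derivative f (at y) b)"
    if "y \<in> S" for y
    using that frechet_derivative_at by metis
  have "Ck_on k S (\<lambda>y. frechet_derivative (\<lambda>y. - f y) (at y) b)" if "b \<in> Basis" for b
    by (rule Ck_on_cong_open[OF assms(1) _ Suc.IH[of "\<lambda>y. frechet_derivative f (at y) b"]])
      (use * Suc.prems that in auto)
  with der show ?case unfolding Ck_on.simps differentiable_def by blast
qed


section \<open>Locality of the covariant derivative\<close>

context smooth_manifold
begin

lemma chart_inj: "p \<in> topspace M \<Longrightarrow> inj_on (x p) (U p)"
  using homeomorphic_imp_injective_map[OF chart_homeo] openin_subset chart_domain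
  by (fastforce simp: Int_absorb1)

lemma chart_image_open:
  assumes p: "p \<in> topspace M" and W: "openin M W"
  shows "open (x p ` (U p \<inter> W))"
proof -
  have "openin (subtopology M (U p)) (U p \<inter> W)"
    using W openin_subtopology by blast
  then have "openin (top_of_set (x p ` U p)) (x p ` (U p \<inter> W))"
    using homeomorphic_imp_open_map[OF chart_homeo[OF p]] by (simp add: open_map_def)
  then show ?thesis
    using chart_image[OF p] openin_open_trans by blast
qed

lemma smooth_field_subset: "smooth_field V X \<Longrightarrow> W \<subseteq> V \<Longrightarrow> smooth_field W X"
  unfolding smooth_field_def smooth_on_def
  by (meson Ck_on_subset image_mono Int_mono subset_refl)

lemma smooth_field_cong:
  assumes "openin M W" "smooth_field W X" "\<And>q. q \<in> W \<Longrightarrow> X q = Y q"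
  shows "smooth_field W Y"
  unfolding smooth_field_def smooth_on_def
proof (intro ballI allI)
  fix p k assume p: "p \<in> topspace M"
  show "Ck_on k (x p ` (U p \<inter> W)) ((\<lambda>q. coords p q (Y q)) \<circ> inv_into (U p) (x p))"
    by (rule Ck_on_cong_open[OF chart_image_open[OF p assms(1)],
          where f="(\<lambda>q. coords p q (X q)) \<circ> inv_into (U p) (x p)"])
      (use assms(2,3) p chart_inj[OF p] in \<open>auto simp: smooth_field_def smooth_on_def\<close>)
qed

lemma linear_coords:
  assumes "p \<in> topspace M" "q \<in> topspace M" "q \<in> U p"
  shows "linear (coords p q)"
proof -
  have "Ck_on 1 (x q ` (U q \<inter> U p)) (x p \<circ> inv_into (U q) (x q))"
    using transition_smooth[OF assms(2,1)] by (simp only: smooth_on_def)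
  moreover have "x q q \<in> x q ` (U q \<inter> U p)"
    using chart_domain assms by blast
  ultimately have "(x p \<circ> inv_into (U q) (x q)) differentiable (at (x q q))"
    unfolding One_nat_def Ck_on.simps(2) by blast
  then show ?thesis
    unfolding coords_def[abs_def] by (rule linear_frechet_derivative)
qed

lemma smooth_field_minus:
  assumes "openin M W" "smooth_field W X"
  shows "smooth_field W (\<lambda>q. - X q)"
  unfolding smooth_field_def smooth_on_def
proof (intro ballI allI)
  fix p k assume p: "p \<in> topspace M"
  have neg: "coords p q (- X q) = - coords p q (X q)" if "q \<in> U p \<inter> W" for q
    using linear_coords[OF p, of q] that assms(1) openin_subset[of M W] linear_neg by blast
  show "Ck_on k (x p ` (U p \<inter> W)) ((\<lambda>q. coords p q (- X q)) \<circ> inv_into (U p) (x p))"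
    by (rule Ck_on_cong_open[OF chart_image_open[OF p assms(1)] _
          Ck_on_minus[OF chart_image_open[OF p assms(1)],
            where f="(\<lambda>q. coords p q (X q)) \<circ> inv_into (U p) (x p)"]])
      (use neg assms(2) p chart_inj[OF p] in \<open>auto simp: smooth_field_def smooth_on_def\<close>)
qed

lemma smooth_fun_locally_const:
  assumes "openin M W" "\<And>q. q \<in> W \<Longrightarrow> f q = c"
  shows "smooth_fun W f"
  unfolding smooth_fun_def smooth_on_def
proof (intro ballI allI)
  fix p k assume p: "p \<in> topspace M"
  show "Ck_on k (x p ` (U p \<inter> W)) (f \<circ> inv_into (U p) (x p))"
    by (rule Ck_on_cong_open[OF chart_image_open[OF p assms(1)] _ Ck_on_const[where c=c]])
      (use assms(2) chart_inj[OF p] in auto)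
qed

lemma lie_deriv_locally_const:
  assumes W: "openin M W" "p \<in> W" and f: "\<And>q. q \<in> W \<Longrightarrow> f q = c"
  shows "lie_deriv X f p = 0"
proof -
  have p: "p \<in> topspace M"
    using W openin_subset by blast
  have "x p p \<in> x p ` (U p \<inter> W)"
    using chart_domain[OF p] W by blast
  then have "((f \<circ> inv_into (U p) (x p)) has_derivative (\<lambda>_. 0)) (at (x p p))"
    by (rule has_derivative_transform_within_open[OF has_derivative_const[of c]
          chart_image_open[OF p W(1)]])
      (use f chart_inj[OF p] in auto)
  then have "frechet_derivative (f \<circ> inv_into (U p) (x p)) (at (x p p)) = (\<lambda>_. 0)"
    using frechet_derivative_at by metis
  then show ?thesis
    by (simp add: lie_deriv_def)
qed

end

context riemannian_manifold
begin

text \<open>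
  The axioms for the connection compare fields as functions on all of the manifold, so its locality
  has to be derived. It follows from the Leibniz rule for functions that are constant on \<open>W\<close> but
  take another value outside.
\<close>

lemma nab_eq_zero_of_zero_on_open:
  assumes W: "openin M W" "p \<in> W" and smooth: "smooth_field W X" "smooth_field W Z"
    and Z: "\<And>q. q \<in> W \<Longrightarrow> Z q = 0"
  shows "nab X Z p = 0"
proof -
  define f where "f q = (if q \<in> W then 0 else 1 :: real)" for q
  have "smooth_fun W f"
    by (rule smooth_fun_locally_const[OF W(1)]) (simp add: f_def)
  moreover have "(\<lambda>q. f q *\<^sub>R Z q) = Z"
    by (auto simp: f_def Z)
  ultimately show ?thesis
    using nab_leibniz[OF W(1) _ smooth W(2), of f] W(2) Z by (simp add: f_def)
qed

lemma nab_minus_on_open: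
  assumes W: "openin M W" "p \<in> W" and smooth: "smooth_field W X" "smooth_field W Y"
    and Z: "\<And>q. q \<in> W \<Longrightarrow> Z q = - Y q"
  shows "nab X Z p = - nab X Y p"
proof -
  have sZ: "smooth_field W Z"
    by (rule smooth_field_cong[OF W(1) smooth_field_minus[OF W(1) smooth(2)]]) (simp add: Z)
  have zero: "smooth_field W (\<lambda>q. Y q + Z q)"
    unfolding smooth_field_def smooth_on_def
  proof (intro ballI allI)
    fix r k assume r: "r \<in> topspace M"
    have zero: "coords r q 0 = 0" if "q \<in> U r \<inter> W" for q
      using linear_coords[OF r, of q] that W(1) openin_subset[of M W] linear_0 by blast
    show "Ck_on k (x r ` (U r \<inter> W)) ((\<lambda>q. coords r q (Y q + Z q)) \<circ> inv_into (U r) (x r))"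
      by (rule Ck_on_cong_open[OF chart_image_open[OF r W(1)] _ Ck_on_const[where c=0]])
        (use zero Z chart_inj[OF r] in auto)
  qed
  have "nab X (\<lambda>q. Y q + Z q) p = 0"
    by (rule nab_eq_zero_of_zero_on_open[OF W smooth(1) zero]) (simp add: Z)
  then show ?thesis
    using nab_add_right[OF W(1) smooth sZ W(2)] by (simp add: add_eq_0_iff)
qed


section \<open>Orthonormal bases\<close>

lemma metric_linear:
  assumes "p \<in> topspace M"
  shows "linear (g p u)" and "linear (\<lambda>v. g p v u)"
  using metric_bilinear[OF assms] by (auto simp: bilinear_def)

lemmas metric_left = linear_add[OF metric_linear(2)] linear_cmul[OF metric_linear(2)]
  linear_neg[OF metric_linear(2)] linear_0[OF metric_linear(2)] linear_diff[OF metric_linear(2)]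
  linear_sum[OF metric_linear(2)]

lemmas metric_right = linear_add[OF metric_linear(1)] linear_cmul[OF metric_linear(1)]
  linear_neg[OF metric_linear(1)] linear_0[OF metric_linear(1)] linear_diff[OF metric_linear(1)]
  linear_sum[OF metric_linear(1)]

text \<open>Orthonormality is relative to \<open>g p\<close>, which is unrelated to the inner product of the model space.\<close>

lemma orthonormal_expansion:
  fixes e :: "nat \<Rightarrow> 'e"
  assumes p: "p \<in> topspace M" and e: "orthonormal_basis p e"
  shows "(\<Sum>i = 1..DIM('e). g p (e i) v *\<^sub>R e i) = v"
proof -
  obtain h where h: "bij_betw h {1..DIM('e)} (Basis :: 'e set)"
    using ex_bij_betw_nat_finite_1[OF finite_Basis] by blast
  \<comment> \<open>\<open>F\<close> is injective since orthonormality recovers the coefficients, hence surjective.\<close>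
  define F where "F c = (\<Sum>i = 1..DIM('e). (c \<bullet> h i) *\<^sub>R e i)" for c :: 'e
  have lin: "linear F"
    unfolding F_def by (intro linearI)
      (simp_all add: inner_add_left sum.distrib scaleR_add_left scaleR_sum_right)
  have coord: "g p (e j) (F c) = c \<bullet> h j" if j: "j \<in> {1..DIM('e)}" for j c
  proof -
    have "g p (e j) (F c) = (\<Sum>i = 1..DIM('e). if j = i then c \<bullet> h i else 0)"
      unfolding F_def metric_right[OF p]
      by (intro sum.cong refl) (use e j in \<open>auto simp: orthonormal_basis_def\<close>)
    then show ?thesis
      using j by simp
  qed
  have "inj F"
  proof (rule injI, rule euclidean_eqI)
    fix c d b :: 'e assume "F c = F d" "b \<in> Basis"
    moreover obtain j where "j \<in> {1..DIM('e)}" "b = h j"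
      using \<open>b \<in> Basis\<close> bij_betw_imp_surj_on[OF h] by blast
    ultimately show "c \<bullet> b = d \<bullet> b"
      using coord by metis
  qed
  then obtain c where c: "v = F c"
    using linear_injective_imp_surjective[OF lin] by (metis surjD)
  show ?thesis
    unfolding c using coord by (simp add: F_def)
qed

lemma metric_expansion:
  fixes e :: "nat \<Rightarrow> 'e"
  assumes p: "p \<in> topspace M" and e: "orthonormal_basis p e"
  shows "g p u v = (\<Sum>i = 1..DIM('e). g p u (e i) * g p (e i) v)"
proof -
  have "g p u v = g p u (\<Sum>i = 1..DIM('e). g p (e i) v *\<^sub>R e i)"
    by (simp only: orthonormal_expansion[OF p e])
  then show ?thesis
    by (simp add: metric_right[OF p] mult.commute)
qed

lemma linear_expansion:
  fixes e :: "nat \<Rightarrow> 'e" and L :: "'e \<Rightarrow> 'c::real_vector"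
  assumes p: "p \<in> topspace M" and e: "orthonormal_basis p e" and L: "linear L"
  shows "(\<Sum>i = 1..DIM('e). g p (e i) v *\<^sub>R L (e i)) = L v"
proof -
  have "L v = L (\<Sum>i = 1..DIM('e). g p (e i) v *\<^sub>R e i)"
    by (simp only: orthonormal_expansion[OF p e])
  then show ?thesis
    by (simp add: linear_sum[OF L] linear_cmul[OF L])
qed

end

section \<open>Bilinear forms on a tangent space\<close>

context almost_contact_metric_manifold
begin

lemma zeta_nonzero: "p \<in> topspace M \<Longrightarrow> zeta p \<noteq> 0"
  using zeta_unit metric_right(4) by fastforce

lemma phi_zeta: "p \<in> topspace M \<Longrightarrow> phi p (zeta p) = 0"
  using phi_metric[of p "zeta p" "zeta p"] metric_pos[of p "phi p (zeta p)"] zeta_unit by force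

lemma zeta_perp_phi:
  assumes p: "p \<in> topspace M"
  shows "g p (zeta p) (phi p v) = 0"
proof -
  have "phi p (phi p (phi p v)) = - phi p v"
    unfolding phi_phi[OF p, of v]
    by (simp add: linear_add[OF phi_linear[OF p]] linear_cmul[OF phi_linear[OF p]]
        linear_diff[OF phi_linear[OF p]] linear_neg[OF phi_linear[OF p]] phi_zeta[OF p])
  then show ?thesis
    using phi_phi[OF p, of "phi p v"] zeta_nonzero[OF p] by simp
qed

lemma phi_skew:
  assumes p: "p \<in> topspace M"
  shows "g p (phi p u) v = - g p u (phi p v)"
  using phi_metric[OF p, of u "phi p v"] zeta_perp_phi[OF p] metric_sym[OF p, of "phi p u" "zeta p"]
  by (simp add: phi_phi[OF p] metric_right[OF p])

text \<open>The orthogonal projection onto the complement of the Reeb vector.\<close>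

definition hor_proj :: "'a \<Rightarrow> 'e \<Rightarrow> 'e" where
  "hor_proj p v = v - g p (zeta p) v *\<^sub>R zeta p"

lemma hor_proj_hor: "p \<in> topspace M \<Longrightarrow> hor_proj p v \<in> hor p"
  by (simp add: hor_def hor_proj_def metric_right zeta_unit)

lemma metric_hor_proj:
  assumes p: "p \<in> topspace M" and u: "u \<in> hor p"
  shows "g p u (hor_proj p v) = g p v u"
proof -
  have "g p u (zeta p) = 0"
    using u metric_sym[OF p, of u "zeta p"] by (simp add: hor_def)
  then show ?thesis
    using metric_sym[OF p, of u v] by (simp add: hor_proj_def metric_right[OF p])
qed

lemma phi_hor: "p \<in> topspace M \<Longrightarrow> phi p v \<in> hor p"
  by (simp add: hor_def zeta_perp_phi)

lemma phi_hor_proj: "p \<in> topspace M \<Longrightarrow> phi p (hor_proj p v) = phi p v"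
  by (simp add: hor_proj_def linear_diff[OF phi_linear] linear_cmul[OF phi_linear] phi_zeta)

text \<open>
  Forms that vanish on the Reeb vector are determined by horizontal vectors. This allows the
  defining identities of the classes, stated for horizontal vectors, to be used for all vectors,
  and hence the traces to be taken in orthonormal bases that are not adapted to the structure.
\<close>

lemma bilinear_hor_proj:
  assumes "bilinear b" "\<And>v. b (zeta p) v = 0" "\<And>u. b u (zeta p) = 0"
  shows "b (hor_proj p u) (hor_proj p v) = b u v"
  using assms by (simp add: hor_proj_def bilinear_lsub bilinear_rsub bilinear_lmul bilinear_rmul)

lemma trace_phi_skew:
  fixes e :: "nat \<Rightarrow> 'e" and B :: "'e \<Rightarrow> 'e \<Rightarrow> 'c::real_vector"
  assumes p: "p \<in> topspace M" and e: "orthonormal_basis p e" and B: "bilinear B"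
  shows "(\<Sum>i = 1..DIM('e). B (phi p (e i)) (e i)) = - (\<Sum>i = 1..DIM('e). B (e i) (phi p (e i)))"
proof -
  have lin: "linear (\<lambda>v. B v w)" "linear (B w)" for w
    using B by (auto simp: bilinear_def)
  have "(\<Sum>i = 1..DIM('e). B (phi p (e i)) (e i))
      = (\<Sum>i = 1..DIM('e). \<Sum>j = 1..DIM('e). g p (e j) (phi p (e i)) *\<^sub>R B (e j) (e i))"
    by (simp only: linear_expansion[OF p e lin(1)])
  also have "\<dots> = (\<Sum>j = 1..DIM('e). \<Sum>i = 1..DIM('e). g p (e j) (phi p (e i)) *\<^sub>R B (e j) (e i))"
    by (rule sum.swap)
  also have "\<dots> = (\<Sum>j = 1..DIM('e). \<Sum>i = 1..DIM('e). - (g p (e i) (phi p (e j)) *\<^sub>R B (e j) (e i)))"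
    by (intro sum.cong refl)
      (metis metric_sym[OF p] phi_skew[OF p] scaleR_minus_left minus_minus)
  also have "\<dots> = - (\<Sum>j = 1..DIM('e). B (e j) (phi p (e j)))"
    by (simp only: sum_negf linear_expansion[OF p e lin(2)])
  finally show ?thesis .
qed

lemma bilinear_mult:
  fixes a b :: "'e \<Rightarrow> real"
  assumes "linear a" "linear b"
  shows "bilinear (\<lambda>u v. a u * b v)"
  using assms by (auto simp: bilinear_def linear_iff algebra_simps)

text \<open>
  The pairing of two bilinear forms, one of which is invariant under \<open>\<phi>\<close> while the other changes
  sign. Moving \<open>\<phi>\<close> from one form to the other costs a sign in each of the two arguments, so the
  sum of \<open>b (\<phi> u, \<phi> v) d (\<phi> u, \<phi> v)\<close> equals that of \<open>b (\<phi>\<^sup>2 u, \<phi>\<^sup>2 v) d (u, v)\<close>; the former is minus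
  the pairing, the latter is the pairing itself.
\<close>

lemma pairing_phi_type_zero:
  fixes e :: "nat \<Rightarrow> 'e" and b d :: "'e \<Rightarrow> 'e \<Rightarrow> real"
  assumes p: "p \<in> topspace M" and e: "orthonormal_basis p e"
    and bil: "bilinear b" "bilinear d" and s: "s * s = 1"
    and b: "\<And>u v. b (phi p u) (phi p v) = s * b u v"
    and d: "\<And>u v. d (phi p u) (phi p v) = - s * d u v"
  shows "(\<Sum>i = 1..DIM('e). \<Sum>j = 1..DIM('e). b (e i) (e j) * d (e i) (e j)) = 0"
    (is "?P = 0")
proof -
  let ?f = "phi p"
  have lin: "linear (\<lambda>v. b v w)" "linear (b w)" "linear (\<lambda>v. d v w)" "linear (d w)" for w
    using bil by (auto simp: bilinear_def)
  have linf: "linear (\<lambda>v. b (?f v) w)" "linear (\<lambda>v. b w (?f v))" for w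
    using linear_compose[OF phi_linear[OF p] lin(1)] linear_compose[OF phi_linear[OF p] lin(2)]
    by (simp_all add: o_def)
  have "(\<Sum>i = 1..DIM('e). \<Sum>j = 1..DIM('e). b (?f (e i)) (?f (e j)) * d (?f (e i)) (?f (e j)))
     = (\<Sum>i = 1..DIM('e). - (\<Sum>j = 1..DIM('e). b (?f (e i)) (?f (?f (e j))) * d (?f (e i)) (e j)))"
    by (intro sum.cong refl)
      (use trace_phi_skew[OF p e bilinear_mult[OF linf(2) lin(4)]] in simp)
  also have "\<dots> = (\<Sum>j = 1..DIM('e). - (\<Sum>i = 1..DIM('e).
                    b (?f (e i)) (?f (?f (e j))) * d (?f (e i)) (e j)))"
    unfolding sum_negf by (subst sum.swap) (rule refl)
  also have "\<dots> = (\<Sum>j = 1..DIM('e). \<Sum>i = 1..DIM('e).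
                    b (?f (?f (e i))) (?f (?f (e j))) * d (e i) (e j))"
    by (simp only: trace_phi_skew[OF p e bilinear_mult[OF linf(1) lin(3)]])
  also have "\<dots> = ?P"
    by (subst sum.swap) (simp add: b mult.assoc[symmetric] s)
  also have "(\<Sum>i = 1..DIM('e). \<Sum>j = 1..DIM('e). b (?f (e i)) (?f (e j)) * d (?f (e i)) (?f (e j)))
     = - ?P"
  proof -
    have "(s * y) * (- s * z) = - (y * z)" for y z :: real
      using s by (metis mult.assoc mult.left_commute mult_minus_left mult_1)
    then show ?thesis
      by (simp only: b d sum_negf)
  qed
  finally show ?thesis by simp
qed

lemma pairing_sym_skew_zero:
  fixes e :: "nat \<Rightarrow> 'e" and b d :: "'e \<Rightarrow> 'e \<Rightarrow> real"
  assumes "\<And>u v. b u v = b v u" "\<And>u v. d u v = - d v u"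
  shows "(\<Sum>i = 1..m. \<Sum>j = 1..m. b (e i) (e j) * d (e i) (e j)) = 0"
    (is "?P = 0")
proof -
  have "?P = (\<Sum>i = 1..m. \<Sum>j = 1..m. - (b (e j) (e i) * d (e j) (e i)))"
    by (intro sum.cong refl) (metis assms mult_minus_right)
  also have "\<dots> = - ?P"
    unfolding sum_negf by (subst sum.swap) (rule refl)
  finally show ?thesis by simp
qed


section \<open>The torsion classes\<close>

lemma torsion_linear:
  assumes "torsion_tensor p t"
  shows "linear (t u)" "linear (\<lambda>v. t v u)"
  using assms by (auto simp: torsion_tensor_def bilinear_def)

lemma torsion_hor_split:
  assumes t: "torsion_tensor p t"
  shows "t v u = t (hor_proj p v) u + g p (zeta p) v *\<^sub>R t (zeta p) u"
proof -
  have "bilinear t"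
    using t by (simp add: torsion_tensor_def)
  then show ?thesis
    by (simp add: hor_proj_def bilinear_lsub bilinear_lmul)
qed

lemma torsion_skew: "torsion_tensor p t \<Longrightarrow> g p (t u v) w = - g p v (t u w)"
  by (simp add: torsion_tensor_def)

lemma torsion_perp:
  assumes "p \<in> topspace M" "torsion_tensor p t"
  shows "g p (t u v) v = 0"
  using torsion_skew[OF assms(2), of u v v] metric_sym[OF assms(1), of v] by simp

lemma bilinear_metric_left:
  assumes p: "p \<in> topspace M" and t: "torsion_tensor p t"
  shows "bilinear (\<lambda>u v. g p (t u v) w)"
  using linear_compose[OF torsion_linear(1)[OF t] metric_linear(2)[OF p]]
    linear_compose[OF torsion_linear(2)[OF t] metric_linear(2)[OF p]]
  by (simp add: bilinear_def o_def)

lemma bilinear_beta: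
  assumes p: "p \<in> topspace M" and t: "torsion_tensor p t"
  shows "bilinear (beta p t)"
  using linear_compose[OF torsion_linear(2)[OF t] metric_linear(2)[OF p]] metric_linear(1)[OF p]
  unfolding bilinear_def beta_def by (simp add: o_def)

text \<open>The identities for the classes 1 to 4 extend from horizontal vectors to all vectors.\<close>

lemma almost_hermitian_global:
  assumes p: "p \<in> topspace M" and t: "almost_hermitian_type p t"
  shows "torsion_tensor p t" "t (zeta p) v = 0" "t v (zeta p) = 0"
    and "t (hor_proj p v) (hor_proj p w) = t v w"
    and "t v (phi p w) = - phi p (t v w)"
proof -
  show tt: "torsion_tensor p t" and z: "\<And>v. t (zeta p) v = 0"
    using t by (auto simp: almost_hermitian_type_def)
  show z': "t v (zeta p) = 0" for v
    using torsion_hor_split[OF tt, of v "zeta p"] z t hor_proj_hor[OF p]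
    by (simp add: almost_hermitian_type_def)
  show proj: "t (hor_proj p v) (hor_proj p w) = t v w" for v w
    using bilinear_hor_proj[of t p] tt z z' by (simp add: torsion_tensor_def)
  have "t v (phi p w) = t (hor_proj p v) (phi p (hor_proj p w))"
    using torsion_hor_split[OF tt, of v] z by (simp add: phi_hor_proj[OF p])
  also have "\<dots> = - phi p (t v w)"
    using t hor_proj_hor[OF p] unfolding almost_hermitian_type_def proj[of v w, symmetric] by blast
  finally show "t v (phi p w) = - phi p (t v w)" .
qed

lemma C1_skew:
  assumes p: "p \<in> topspace M" and t: "C1 p t"
  shows "t v w = - t w v"
  using t almost_hermitian_global(4)[OF p, of t] hor_proj_hor[OF p] unfolding C1_def by metis

lemma phi_phi_hermitian:
  assumes p: "p \<in> topspace M" and t: "almost_hermitian_type p t"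
  shows "phi p (phi p (t v w)) = - t v w"
proof -
  have "g p (t v w) (zeta p) = 0"
    using torsion_skew[OF almost_hermitian_global(1)[OF p t]] almost_hermitian_global(3)[OF p t]
      metric_right(4)[OF p] by simp
  then show ?thesis
    using phi_phi[OF p] metric_sym[OF p] by simp
qed

lemma C1_C2_phi:
  assumes p: "p \<in> topspace M" and t: "C1 p t \<or> C2 p t"
  shows "t (phi p v) (phi p w) = - t v w"
  using t
proof
  assume C1: "C1 p t"
  then have h: "almost_hermitian_type p t"
    by (simp add: C1_def)
  have "t (phi p v) (phi p w) = - phi p (t (phi p v) w)"
    by (rule almost_hermitian_global(5)[OF p h])
  also have "\<dots> = phi p (t w (phi p v))"
    by (simp add: C1_skew[OF p C1, of "phi p v" w] linear_neg[OF phi_linear[OF p]])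
  also have "\<dots> = - t v w"
    by (simp add: almost_hermitian_global(5)[OF p h] linear_neg[OF phi_linear[OF p]]
        phi_phi_hermitian[OF p h] C1_skew[OF p C1, of v w])
  finally show ?thesis .
next
  assume C2: "C2 p t"
  then have h: "almost_hermitian_type p t"
    by (simp add: C2_def)
  show ?thesis
    using C2 hor_proj_hor[OF p] almost_hermitian_global(4)[OF p h] phi_hor_proj[OF p]
    unfolding C2_def by metis
qed

lemma C3_C4_phi:
  assumes p: "p \<in> topspace M" and t: "C3 p t \<or> C4 p t"
  shows "t (phi p v) (phi p w) = t v w"
  using t
proof
  assume C3: "C3 p t"
  then have h: "almost_hermitian_type p t"
    by (simp add: C3_def)
  show ?thesis
    using C3 hor_proj_hor[OF p] almost_hermitian_global(4)[OF p h] phi_hor_proj[OF p]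
    unfolding C3_def by metis
next
  assume C4: "C4 p t"
  then have h: "almost_hermitian_type p t"
    by (simp add: C4_def)
  obtain \<theta> a where lin: "linear \<theta>" and \<theta>: "\<theta> (zeta p) = 0" "\<And>v. g p a v = \<theta> v"
    and t4: "\<And>v w. v \<in> hor p \<Longrightarrow> w \<in> hor p \<Longrightarrow>
       4 *\<^sub>R t v w = g p v w *\<^sub>R a - \<theta> w *\<^sub>R v - g p (phi p v) w *\<^sub>R phi p a
                       + g p (phi p a) w *\<^sub>R phi p v"
    using C4 unfolding C4_def by blast
  have "t (phi p v) (phi p w) = t v w" if v: "v \<in> hor p" and w: "w \<in> hor p" for v w
  proof -
    have ff: "phi p (phi p v) = - v"
      using v by (simp add: phi_phi[OF p] hor_def)
    have gf: "g p (phi p v) (phi p w) = g p v w" and ga: "g p (phi p a) (phi p w) = \<theta> w"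
      using v w by (simp_all add: phi_metric[OF p] hor_def \<theta>(2))
    have "4 *\<^sub>R t (phi p v) (phi p w) = 4 *\<^sub>R t v w"
      unfolding t4[OF v w] t4[OF phi_hor[OF p] phi_hor[OF p]] ff gf ga
      by (simp add: metric_left[OF p] phi_skew[OF p] \<theta>(2))
    then show ?thesis by simp
  qed
  then show ?thesis
    using hor_proj_hor[OF p] almost_hermitian_global(4)[OF p h] phi_hor_proj[OF p] by metis
qed

lemma zeta_derivative_beta:
  assumes p: "p \<in> topspace M" and s: "zeta_derivative_type p s"
  shows "beta p s (hor_proj p u) (hor_proj p v) = beta p s u v"
proof (rule bilinear_hor_proj[where b = "beta p s"])
  show "bilinear (beta p s)"
    using s by (intro bilinear_beta[OF p]) (simp add: zeta_derivative_type_def)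
qed (use s torsion_perp[OF p] in
    \<open>auto simp: zeta_derivative_type_def beta_def metric_left[OF p]\<close>)

lemma beta_phi_global:
  assumes p: "p \<in> topspace M" and s: "zeta_derivative_type p s"
    and inv: "\<forall>v\<in>hor p. \<forall>w\<in>hor p. beta p s (phi p v) (phi p w) = c * beta p s v w"
  shows "beta p s (phi p v) (phi p w) = c * beta p s v w"
  using inv hor_proj_hor[OF p] zeta_derivative_beta[OF p s] phi_hor_proj[OF p] by metis

lemma C5_to_C8_phi:
  assumes p: "p \<in> topspace M" and s: "C5 p s \<or> C6 p s \<or> C7 p s \<or> C8 p s"
  shows "beta p s (phi p v) (phi p w) = 1 * beta p s v w"
proof (rule beta_phi_global[OF p])
  show "zeta_derivative_type p s"
    using s by (auto simp: C5_def C6_def C7_def C8_def)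
  show "\<forall>v\<in>hor p. \<forall>w\<in>hor p. beta p s (phi p v) (phi p w) = 1 * beta p s v w"
    using s
  proof (elim disjE)
    assume "C5 p s"
    then obtain c where c: "\<And>v w. v \<in> hor p \<Longrightarrow> w \<in> hor p \<Longrightarrow> beta p s v w = c * g p v w"
      unfolding C5_def by blast
    show ?thesis
      using c phi_hor[OF p] by (auto simp: phi_metric[OF p] hor_def)
  next
    assume "C6 p s"
    then obtain c where c: "\<And>v w. v \<in> hor p \<Longrightarrow> w \<in> hor p \<Longrightarrow>
        beta p s v w = c * fundamental_form p v w"
      unfolding C6_def by blast
    show ?thesis
      using c phi_hor[OF p] by (auto simp: phi_metric[OF p] hor_def fundamental_form_def)
  qed (unfold C7_def C8_def mult_1, blast+)
qed

lemma C9_C10_phi: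
  assumes p: "p \<in> topspace M" and s: "C9 p s \<or> C10 p s"
  shows "beta p s (phi p v) (phi p w) = - 1 * beta p s v w"
proof (rule beta_phi_global[OF p])
  show "zeta_derivative_type p s"
    using s unfolding C9_def C10_def by blast
  show "\<forall>v\<in>hor p. \<forall>w\<in>hor p. beta p s (phi p v) (phi p w) = - 1 * beta p s v w"
    using s unfolding C9_def C10_def by (metis mult_minus1)
qed


section \<open>The mixed term of two torsion components\<close>

text \<open>
  The sum of \<open>\<langle>s\<^sub>e\<zeta>, t\<^sub>e w\<rangle>\<close> over the orthonormal basis \<open>e\<close>.
\<close>

definition mixed_term :: "'a \<Rightarrow> (nat \<Rightarrow> 'e) \<Rightarrow> 'e \<Rightarrow> ('e \<Rightarrow> 'e \<Rightarrow> 'e) \<Rightarrow> ('e \<Rightarrow> 'e \<Rightarrow> 'e) \<Rightarrow> real" where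
  "mixed_term p e w s t = (\<Sum>i = 1..DIM('e). g p (s (e i) (zeta p)) (t (e i) w))"

lemma mixed_term_eq_pairing:
  fixes e :: "nat \<Rightarrow> 'e"
  assumes p: "p \<in> topspace M" and e: "orthonormal_basis p e" and t: "torsion_tensor p t"
  shows "mixed_term p e w s t =
    - (\<Sum>i = 1..DIM('e). \<Sum>j = 1..DIM('e). beta p s (e i) (e j) * g p (t (e i) (e j)) w)"
proof -
  have "g p (e j) (t u w) = - g p (t u (e j)) w" for u j
    using torsion_skew[OF t] metric_sym[OF p] by (metis minus_minus)
  then show ?thesis
    unfolding mixed_term_def beta_def
    by (subst metric_expansion[OF p e]) (simp add: sum_negf)
qed

lemma mixed_term_zero_if_zeta_parallel:
  assumes p: "p \<in> topspace M" and "\<And>v. s v (zeta p) = 0"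
  shows "mixed_term p e w s t = 0"
  using assms(2) by (simp add: mixed_term_def metric_left[OF p])

lemma mixed_term_vertical_left:
  fixes e :: "nat \<Rightarrow> 'e"
  assumes p: "p \<in> topspace M" and e: "orthonormal_basis p e"
    and s: "torsion_tensor p s" "\<forall>v\<in>hor p. \<forall>w. s v w = 0" and t: "torsion_tensor p t"
  shows "mixed_term p e w s t = g p (s (zeta p) (zeta p)) (t (zeta p) w)"
proof -
  have sv: "s v (zeta p) = g p (zeta p) v *\<^sub>R s (zeta p) (zeta p)" for v
    using torsion_hor_split[OF s(1), of v "zeta p"] s(2) hor_proj_hor[OF p] by simp
  have "mixed_term p e w s t
      = (\<Sum>i = 1..DIM('e). g p (e i) (zeta p) *\<^sub>R g p (s (zeta p) (zeta p)) (t (e i) w))"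
    unfolding mixed_term_def
    by (intro sum.cong refl) (simp add: sv[of "e _"] metric_left[OF p] metric_sym[OF p, of "zeta p" "e _"])
  also have "\<dots> = g p (s (zeta p) (zeta p)) (t (zeta p) w)"
    by (rule linear_expansion[OF p e,
          where L = "\<lambda>v. g p (s (zeta p) (zeta p)) (t v w)"])
      (use linear_compose[OF torsion_linear(2)[OF t] metric_linear(1)[OF p]]
        in \<open>simp add: o_def\<close>)
  finally show ?thesis .
qed

lemma mixed_term_vertical_right:
  fixes e :: "nat \<Rightarrow> 'e"
  assumes p: "p \<in> topspace M" and e: "orthonormal_basis p e"
    and s: "torsion_tensor p s" "s (zeta p) (zeta p) = 0"
    and t: "torsion_tensor p t" "\<forall>v\<in>hor p. \<forall>w. t v w = 0"
  shows "mixed_term p e w s t = 0"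
proof -
  have tv: "t v w = g p (zeta p) v *\<^sub>R t (zeta p) w" for v
    using torsion_hor_split[OF t(1), of v w] t(2) hor_proj_hor[OF p] by simp
  have "mixed_term p e w s t
      = (\<Sum>i = 1..DIM('e). g p (e i) (zeta p) *\<^sub>R g p (s (e i) (zeta p)) (t (zeta p) w))"
    unfolding mixed_term_def
    by (intro sum.cong refl) (simp add: tv[of "e _"] metric_right[OF p] metric_sym[OF p, of "zeta p" "e _"])
  also have "\<dots> = g p (s (zeta p) (zeta p)) (t (zeta p) w)"
    by (rule linear_expansion[OF p e,
          where L = "\<lambda>v. g p (s v (zeta p)) (t (zeta p) w)"])
      (use linear_compose[OF torsion_linear(2)[OF s(1)] metric_linear(2)[OF p]]
        in \<open>simp add: o_def\<close>)
  finally show ?thesis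
    by (simp add: s(2) metric_left[OF p])
qed

lemma vertical_of_perp_hor:
  assumes p: "p \<in> topspace M" and u: "\<And>w. w \<in> hor p \<Longrightarrow> g p u w = 0"
  shows "u = g p (zeta p) u *\<^sub>R zeta p"
proof -
  have "hor_proj p u \<in> hor p"
    by (rule hor_proj_hor[OF p])
  then have "g p (hor_proj p u) (hor_proj p u) = 0"
    using u[of "hor_proj p u"] unfolding hor_def by (simp add: hor_proj_def[of p u] metric_left[OF p])
  then have "hor_proj p u = 0"
    using metric_pos[OF p] by fastforce
  then show ?thesis
    by (simp add: hor_proj_def)
qed

text \<open>Here \<open>t\<^sub>v w\<close> is vertical, whereas \<open>s\<^sub>v\<zeta>\<close> is horizontal.\<close>

lemma mixed_term_zeta_derivative:
  fixes e :: "nat \<Rightarrow> 'e"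
  assumes p: "p \<in> topspace M" and w: "w \<in> hor p"
    and s: "zeta_derivative_type p s" and t: "zeta_derivative_type p t"
  shows "mixed_term p e w s t = 0"
proof -
  have ts: "torsion_tensor p s" and tt: "torsion_tensor p t"
    using s t by (auto simp: zeta_derivative_type_def)
  have "g p (t v w) u = 0" if u: "u \<in> hor p" for u v
    using torsion_hor_split[OF tt, of v w] t u w hor_proj_hor[OF p]
    unfolding zeta_derivative_type_def by simp
  then have "t v w = g p (zeta p) (t v w) *\<^sub>R zeta p" for v
    by (rule vertical_of_perp_hor[OF p])
  then have "g p (s v (zeta p)) (t v w) = 0" for v
    using torsion_perp[OF p ts, of v "zeta p"] metric_right(2)[OF p]
    by (metis mult_zero_right real_scaleR_def)
  then show ?thesis
    by (simp add: mixed_term_def)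
qed

lemma mixed_term_phi_type:
  fixes e :: "nat \<Rightarrow> 'e"
  assumes p: "p \<in> topspace M" and e: "orthonormal_basis p e"
    and "(C1 p t \<or> C2 p t) \<and> (C5 p s \<or> C6 p s \<or> C7 p s \<or> C8 p s) \<or>
         (C3 p t \<or> C4 p t) \<and> (C9 p s \<or> C10 p s)"
  shows "mixed_term p e w s t = 0"
proof -
  have ts: "torsion_tensor p s" and tt: "torsion_tensor p t"
    using assms(3) unfolding C1_def C2_def C3_def C4_def C5_def C6_def C7_def C8_def C9_def C10_def
      almost_hermitian_type_def zeta_derivative_type_def by blast+
  obtain c :: real where c: "c * c = 1"
    "\<And>u v. beta p s (phi p u) (phi p v) = c * beta p s u v"
    "\<And>u v. g p (t (phi p u) (phi p v)) w = - c * g p (t u v) w"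
  proof (cases "C1 p t \<or> C2 p t")
    case False
    then show ?thesis
      using that[of "-1"] assms(3) C9_C10_phi[OF p, of s] C3_C4_phi[OF p, of t] by simp
  next
    case True
    show ?thesis
    proof (cases "C5 p s \<or> C6 p s \<or> C7 p s \<or> C8 p s")
      case True
      then show ?thesis
        using that[of 1] \<open>C1 p t \<or> C2 p t\<close> C5_to_C8_phi[OF p True] C1_C2_phi[OF p, of t]
        by (simp add: metric_left[OF p])
    next
      case False
      then show ?thesis
        using that[of "-1"] assms(3) C9_C10_phi[OF p, of s] C3_C4_phi[OF p, of t] by simp
    qed
  qed
  show ?thesis
    unfolding mixed_term_eq_pairing[OF p e tt]
    using pairing_phi_type_zero[where b = "beta p s" and d = "\<lambda>u v. g p (t u v) w" and s = c,
        OF p e bilinear_beta[OF p ts] bilinear_metric_left[OF p tt] c]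
    by simp
qed

lemma mixed_term_C9_C1:
  fixes e :: "nat \<Rightarrow> 'e"
  assumes p: "p \<in> topspace M" and e: "orthonormal_basis p e" and s: "C9 p s" and t: "C1 p t"
  shows "mixed_term p e w s t = 0"
proof -
  have tt: "torsion_tensor p t"
    using t by (simp add: C1_def almost_hermitian_type_def)
  have sym: "beta p s u v = beta p s v u" for u v
    using s hor_proj_hor[OF p] zeta_derivative_beta[OF p, of s] unfolding C9_def by metis
  have skew: "g p (t u v) w = - g p (t v u) w" for u v
    using C1_skew[OF p t, of u v] by (simp add: metric_left[OF p])
  show ?thesis
    unfolding mixed_term_eq_pairing[OF p e tt]
    by (simp only: minus_zero pairing_sym_skew_zero[where b = "beta p s"
          and d = "\<lambda>u v. g p (t u v) w", OF sym skew])
qed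

text \<open>
  For \<open>s\<close> in the classes 5 and 6, \<open>s\<^sub>u\<zeta>\<close> is a combination of the horizontal part of \<open>u\<close> and of
  \<open>\<phi> u\<close>. Since \<open>t\<^sub>u \<phi> u = - \<phi> t\<^sub>u u\<close>, the mixed term reduces to the trace of \<open>t\<close>.
\<close>

lemma mixed_term_C5_C6_C3:
  fixes e :: "nat \<Rightarrow> 'e"
  assumes p: "p \<in> topspace M" and e: "orthonormal_basis p e"
    and s: "C5 p s \<or> C6 p s" and t: "C3 p t"
  shows "mixed_term p e w s t = 0"
proof -
  have h: "almost_hermitian_type p t" and tr: "(\<Sum>i = 1..DIM('e). t (e i) (e i)) = 0"
    using t e by (auto simp: C3_def dim)
  note H = almost_hermitian_global[OF p h]
  have z: "zeta_derivative_type p s"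
    using s by (auto simp: C5_def C6_def)
  have lin: "linear (\<lambda>u. g p (t u v) w)" "linear (\<lambda>u. g p (t v u) w)" for v
    using bilinear_metric_left[OF p H(1)] by (auto simp: bilinear_def)
  have tproj: "t (hor_proj p v) u = t v u" "t v (hor_proj p u) = t v u" for u v
    using torsion_hor_split[OF H(1), of v u] H(2,3)
    by (simp_all add: hor_proj_def linear_diff[OF torsion_linear(1)[OF H(1)]]
        linear_cmul[OF torsion_linear(1)[OF H(1)]])
  from s obtain c a where beta: "\<And>u v. beta p s u v = g p v (c *\<^sub>R hor_proj p u + a *\<^sub>R phi p u)"
  proof
    assume "C5 p s"
    then obtain c where c: "\<And>v w. v \<in> hor p \<Longrightarrow> w \<in> hor p \<Longrightarrow> beta p s v w = c * g p v w"
      unfolding C5_def by blast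
    have "beta p s u v = g p v (c *\<^sub>R hor_proj p u + 0 *\<^sub>R phi p u)" for u v
      using c[OF hor_proj_hor[OF p] hor_proj_hor[OF p], of u v]
      by (simp add: zeta_derivative_beta[OF p z] metric_hor_proj[OF p hor_proj_hor[OF p]]
          metric_right[OF p])
    then show thesis using that by blast
  next
    assume "C6 p s"
    then obtain c where c: "\<And>v w. v \<in> hor p \<Longrightarrow> w \<in> hor p \<Longrightarrow>
        beta p s v w = c * fundamental_form p v w"
      unfolding C6_def by blast
    have "beta p s u v = g p v (0 *\<^sub>R hor_proj p u + (- c) *\<^sub>R phi p u)" for u v
    proof -
      have "beta p s u v = c * g p (hor_proj p u) (phi p v)"
        using c[OF hor_proj_hor[OF p] hor_proj_hor[OF p], of u v]
        by (simp add: zeta_derivative_beta[OF p z] fundamental_form_def phi_hor_proj[OF p])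
      also have "g p (hor_proj p u) (phi p v) = - g p v (phi p u)"
        using phi_skew[OF p, of v "hor_proj p u"]
        by (simp add: metric_sym[OF p, of "hor_proj p u" "phi p v"] phi_hor_proj[OF p])
      finally show ?thesis
        by (simp add: metric_right[OF p])
    qed
    then show thesis using that by blast
  qed
  have inner: "(\<Sum>j = 1..DIM('e). beta p s u (e j) * g p (t u (e j)) w)
      = c * g p (t u u) w - a * g p (phi p (t u u)) w" for u
  proof -
    have "(\<Sum>j = 1..DIM('e). beta p s u (e j) * g p (t u (e j)) w)
        = g p (t u (c *\<^sub>R hor_proj p u + a *\<^sub>R phi p u)) w"
      using linear_expansion[OF p e lin(2)] by (simp add: beta)
    then show ?thesis
      by (simp add: linear_add[OF torsion_linear(1)[OF H(1)]] linear_cmul[OF torsion_linear(1)[OF H(1)]]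
          metric_left[OF p] tproj H(5))
  qed
  have "(\<Sum>i = 1..DIM('e). g p (t (e i) (e i)) w) = 0"
    using tr by (simp add: metric_left[OF p] flip: metric_left(6)[OF p])
  moreover have "(\<Sum>i = 1..DIM('e). g p (phi p (t (e i) (e i))) w) = 0"
    using tr by (simp add: metric_left[OF p] linear_0[OF phi_linear[OF p]]
        flip: metric_left(6)[OF p] linear_sum[OF phi_linear[OF p]])
  ultimately show ?thesis
    unfolding mixed_term_eq_pairing[OF p e H(1)] inner
    by (simp add: sum_subtractf flip: sum_distrib_left)
qed


section \<open>The Laplacian of the Reeb field\<close>

lemma torsion_class_simps:
  "torsion_class 1 = C1" "torsion_class 2 = C2" "torsion_class 3 = C3" "torsion_class 4 = C4"
  "torsion_class 5 = C5" "torsion_class 6 = C6" "torsion_class 7 = C7" "torsion_class 8 = C8"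
  "torsion_class 9 = C9" "torsion_class 10 = C10" "torsion_class 11 = C11" "torsion_class 12 = C12"
  by (simp_all add: torsion_class_def)

lemma torsion_class_imp:
  "i \<in> {1..4} \<Longrightarrow> torsion_class i p t \<Longrightarrow> almost_hermitian_type p t"
  "i \<in> {5..10} \<Longrightarrow> torsion_class i p t \<Longrightarrow> zeta_derivative_type p t"
  "i \<in> {1..12} \<Longrightarrow> torsion_class i p t \<Longrightarrow> torsion_tensor p t"
proof -
  have sets: "{1..4} = {1, 2, 3, 4 :: nat}" "{5..10} = {5, 6, 7, 8, 9, 10 :: nat}"
    "{1..12} = {1..4} \<union> {5..10} \<union> {11, 12 :: nat}"
    by auto
  note defs = torsion_class_simps C1_def C2_def C3_def C4_def C5_def C6_def C7_def C8_def C9_def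
    C10_def C11_def C12_def
  show 1: "i \<in> {1..4} \<Longrightarrow> torsion_class i p t \<Longrightarrow> almost_hermitian_type p t"
    unfolding sets by (elim insertE emptyE; hypsubst; unfold defs; blast)
  show 2: "i \<in> {5..10} \<Longrightarrow> torsion_class i p t \<Longrightarrow> zeta_derivative_type p t"
    unfolding sets by (elim insertE emptyE; hypsubst; unfold defs; blast)
  have 3: "i \<in> {11, 12} \<Longrightarrow> torsion_class i p t \<Longrightarrow> torsion_tensor p t"
    by (elim insertE emptyE; hypsubst; unfold defs; blast)
  show "i \<in> {1..12} \<Longrightarrow> torsion_class i p t \<Longrightarrow> torsion_tensor p t"
    using 1 2 3 unfolding sets(3) almost_hermitian_type_def zeta_derivative_type_def by blast
qed

lemma mixed_term_zero:
  fixes e :: "nat \<Rightarrow> 'e"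
  assumes p: "p \<in> topspace M" and e: "orthonormal_basis p e" and w: "w \<in> hor p"
    and i: "i \<in> {1..12}" "torsion_class i p s" and j: "j \<in> {1..12}" "torsion_class j p t"
    and compat: "\<not> (i = 12 \<and> j = 11)"
      "i \<in> {5..10} \<Longrightarrow> j \<in> {1..4} \<Longrightarrow>
        (i, j) \<in> {5, 6, 7, 8} \<times> {1, 2} \<union> {9, 10} \<times> {3, 4} \<union> {(9, 1), (5, 3), (6, 3)}"
  shows "mixed_term p e w s t = 0"
proof -
  note ts = torsion_class_imp(3)[OF i] and tt = torsion_class_imp(3)[OF j]
  consider "i \<in> {1..4}" | "i = 11" | "i = 12" | "i \<in> {5..10}" "j \<in> {5..10}"
    | "i \<in> {5..10}" "j \<in> {11, 12}" | "i \<in> {5..10}" "j \<in> {1..4}"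
    using i(1) j(1) by force
  then show ?thesis
  proof cases
    case 1
    show ?thesis
      by (intro mixed_term_zero_if_zeta_parallel[OF p]
          almost_hermitian_global(3)[OF p torsion_class_imp(1)[OF 1 i(2)]])
  next
    case 2
    then have "C11 p s"
      using i(2) by (simp add: torsion_class_simps)
    then show ?thesis
      using mixed_term_vertical_left[OF p e ts _ tt] by (simp add: C11_def metric_left[OF p])
  next
    case 3
    then have s: "C12 p s"
      using i(2) by (simp add: torsion_class_simps)
    consider "j \<in> {1..4}" | "j \<in> {5..10}" | "j = 12"
      using j(1) compat(1) 3 by force
    then have "g p (s (zeta p) (zeta p)) (t (zeta p) w) = 0"
    proof cases
      case 1
      then show ?thesis
        using almost_hermitian_global(2)[OF p torsion_class_imp(1)[OF 1 j(2)]]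
        by (simp add: metric_right[OF p])
    next
      case 2
      then show ?thesis
        using torsion_class_imp(2)[OF 2 j(2)]
        by (simp add: zeta_derivative_type_def metric_right[OF p])
    next
      case 3
      then have "C12 p t"
        using j(2) by (simp add: torsion_class_simps)
      then have "t (zeta p) w = g p (zeta p) (t (zeta p) w) *\<^sub>R zeta p"
        using vertical_of_perp_hor[OF p, of "t (zeta p) w"] w unfolding C12_def by blast
      then show ?thesis
        using torsion_perp[OF p ts] metric_right(2)[OF p]
        by (metis mult_zero_right real_scaleR_def)
    qed
    then show ?thesis
      using mixed_term_vertical_left[OF p e ts _ tt] s by (simp add: C12_def)
  next
    case 4
    show ?thesis
      by (rule mixed_term_zeta_derivative[OF p w torsion_class_imp(2)[OF 4(1) i(2)]
            torsion_class_imp(2)[OF 4(2) j(2)]])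
  next
    case 5
    have "s (zeta p) (zeta p) = 0"
      using torsion_class_imp(2)[OF 5(1) i(2)] by (simp add: zeta_derivative_type_def)
    moreover have "\<forall>v\<in>hor p. \<forall>w. t v w = 0"
      using 5(2) j(2) by (auto simp: torsion_class_simps C11_def C12_def)
    ultimately show ?thesis
      using mixed_term_vertical_right[OF p e ts _ tt] by blast
  next
    case 6
    consider "i \<in> {5, 6, 7, 8}" "j \<in> {1, 2}" | "i \<in> {9, 10}" "j \<in> {3, 4}" | "i = 9" "j = 1"
      | "i \<in> {5, 6}" "j = 3"
      using compat(2)[OF 6] by blast
    then show ?thesis
    proof cases
      case 1
      have "C5 p s \<or> C6 p s \<or> C7 p s \<or> C8 p s"
        using 1(1) i(2) by (auto simp: torsion_class_simps)
      moreover have "C1 p t \<or> C2 p t"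
        using 1(2) j(2) by (metis torsion_class_simps(1,2) insertE singletonD)
      ultimately show ?thesis
        using mixed_term_phi_type[OF p e] by blast
    next
      case 2
      have "C9 p s \<or> C10 p s" "C3 p t \<or> C4 p t"
        using 2 i(2) j(2) by (auto simp: torsion_class_simps)
      then show ?thesis
        using mixed_term_phi_type[OF p e] by blast
    next
      case 3
      then show ?thesis
        using mixed_term_C9_C1[OF p e] i(2) j(2) torsion_class_simps(1,9) by metis
    next
      case 4
      then show ?thesis
        using mixed_term_C5_C6_C3[OF p e] i(2) j(2) by (auto simp: torsion_class_simps)
    qed
  qed
qed

text \<open>
  The term with \<open>\<nabla>\<phi>\<close> vanishes because \<open>\<phi> \<zeta> = 0\<close>, the term with \<open>\<nabla>\<eta>\<close> because \<open>\<zeta>\<close> has constant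
  length.
\<close>

lemma xi_zeta:
  assumes W: "openin M W" "p \<in> W" and X: "smooth_field W X"
  shows "xi X zeta p = - nab X zeta p"
proof -
  have sub: "W \<subseteq> topspace M"
    by (rule openin_subset[OF W(1)])
  then have p: "p \<in> topspace M"
    using W(2) by blast
  have z: "smooth_field W zeta"
    by (rule smooth_field_subset[OF zeta_smooth sub])
  have f1: "smooth_field W (phi_field zeta)"
    using phi_smooth[OF W(1) z] by (simp add: phi_field_def[abs_def])
  then have f2: "smooth_field W (phi_field (phi_field zeta))"
    using phi_smooth[OF W(1) f1] by (simp add: phi_field_def[abs_def])
  have f0: "phi_field zeta q = 0" "phi_field (phi_field zeta) q = 0" if "q \<in> W" for q
    using that sub phi_zeta linear_0[OF phi_linear] by (auto simp: phi_field_def)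
  have "nab_phi X (phi_field zeta) p = 0"
    unfolding nab_phi_def
    using nab_eq_zero_of_zero_on_open[OF W X f1 f0(1)] nab_eq_zero_of_zero_on_open[OF W X f2 f0(2)]
    by (simp add: linear_0[OF phi_linear[OF p]])
  moreover have lie: "lie_deriv X (\<lambda>q. g q (zeta q) (zeta q)) p = 0"
    by (rule lie_deriv_locally_const[OF W, where c = 1]) (use sub zeta_unit in blast)
  then have "eta p (nab X zeta p) = 0"
    using nab_metric[OF W(1) X z z W(2)] metric_sym[OF p, of _ "zeta p"] by (simp add: eta_def)
  then have "nab_eta X zeta p = 0"
    using lie by (simp add: nab_eta_def eta_def)
  ultimately show ?thesis
    by (simp add: xi_def eta_def zeta_unit[OF p])
qed

text \<open>\<open>T\<close> is the value of the intrinsic torsion at \<open>p\<close>; it makes the operator \<open>xi\<close> tensorial there.\<close>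

lemma rough_laplacian_zeta:
  fixes e :: "nat \<Rightarrow> 'a \<Rightarrow> 'e"
  assumes h: harmonic_structure and e: "orthonormal_frame W e" and p: "p \<in> W"
    and T: "\<And>X Y. smooth_field W X \<Longrightarrow> smooth_field W Y \<Longrightarrow> xi X Y p = T (X p) (Y p)"
    and lin: "\<And>v. linear (T v)"
  shows "rough_laplacian e zeta p = - (\<Sum>i = 1..DIM('e). T (e i p) (T (e i p) (zeta p)))"
proof -
  have W: "openin M W" and se: "\<And>i. i \<in> {1..DIM('e)} \<Longrightarrow> smooth_field W (e i)"
    using e by (auto simp: orthonormal_frame_def)
  have z: "smooth_field W zeta"
    by (rule smooth_field_subset[OF zeta_smooth openin_subset[OF W]])
  have "nab_xi (e i) (e i) zeta p = - second_nab (e i) (e i) zeta p + T (e i p) (T (e i p) (zeta p))"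
    if i: "i \<in> {1..DIM('e)}" for i
  proof -
    have nz: "smooth_field W (nab (e i) zeta)" and ne: "smooth_field W (nab (e i) (e i))"
      using nab_smooth[OF W se[OF i]] z se[OF i] by blast+
    have "nab (e i) (xi (e i) zeta) p = - nab (e i) (nab (e i) zeta) p"
      by (rule nab_minus_on_open[OF W p se[OF i] nz]) (rule xi_zeta[OF W _ se[OF i]])
    moreover have "xi (nab (e i) (e i)) zeta p = - nab (nab (e i) (e i)) zeta p"
      by (rule xi_zeta[OF W p ne])
    moreover have "nab (e i) zeta p = - T (e i p) (zeta p)"
      using xi_zeta[OF W p se[OF i]] T[OF se[OF i] z] by simp
    then have "xi (e i) (nab (e i) zeta) p = - T (e i p) (T (e i p) (zeta p))"
      using T[OF se[OF i] nz] by (simp add: linear_neg[OF lin])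
    ultimately show ?thesis
      by (simp add: nab_xi_def second_nab_def)
  qed
  then have "codiff_xi e zeta p = (\<Sum>i = 1..DIM('e). second_nab (e i) (e i) zeta p)
      - (\<Sum>i = 1..DIM('e). T (e i p) (T (e i p) (zeta p)))"
    by (simp add: codiff_xi_def sum_subtractf)
  moreover have "codiff_xi e zeta p = 0"
    using h e z p unfolding harmonic_structure_def by blast
  ultimately show ?thesis
    by (simp add: rough_laplacian_def)
qed

lemma harmonic_reeb_of_mixed_term_zero:
  assumes h: harmonic_structure and t: "torsion_decomposition t"
    and mixed: "\<And>p e w i j. p \<in> topspace M \<Longrightarrow> orthonormal_basis p e \<Longrightarrow> w \<in> hor p \<Longrightarrow>
      i \<in> {1..12} \<Longrightarrow> j \<in> {1..12} \<Longrightarrow> mixed_term p e w (t i p) (t j p) = 0"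
  shows "harmonic_unit_vector_field zeta"
  unfolding harmonic_unit_vector_field_def
proof (intro conjI ballI allI impI)
  fix W p and e :: "nat \<Rightarrow> 'a \<Rightarrow> 'e"
  assume e: "orthonormal_frame W e" and pW: "p \<in> W"
  have W: "openin M W" and se: "\<And>i. i \<in> {1..DIM('e)} \<Longrightarrow> smooth_field W (e i)"
    and basis: "orthonormal_basis p (\<lambda>i. e i p)"
    using e pW by (auto simp: orthonormal_frame_def)
  have p: "p \<in> topspace M"
    using openin_subset[OF W] pW by blast
  have z: "smooth_field W zeta"
    by (rule smooth_field_subset[OF zeta_smooth openin_subset[OF W]])
  define T where "T v w = (\<Sum>i = 1..12. t i p v w)" for v w
  have tt: "torsion_tensor p (t i p)" if "i \<in> {1..12}" for i
    using t torsion_class_imp(3)[OF that] that p unfolding torsion_decomposition_def by blast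
  have T: "xi X Y p = T (X p) (Y p)" if "smooth_field W X" "smooth_field W Y" for X Y
    using t that W pW unfolding torsion_decomposition_def T_def by blast
  have linT: "linear (T v)" for v
    unfolding T_def by (intro linear_compose_sum ballI torsion_linear(1)[OF tt])
  have skewT: "g p (T u v) w = - g p v (T u w)" for u v w
    using torsion_skew[OF tt]
    by (simp add: T_def metric_left[OF p] metric_right[OF p] flip: sum_negf)
  define L where "L = rough_laplacian e zeta p"
  have L: "g p L w = (\<Sum>i = 1..DIM('e). g p (T (e i p) (zeta p)) (T (e i p) w))" for w
  proof -
    have "L = - (\<Sum>i = 1..DIM('e). T (e i p) (T (e i p) (zeta p)))"
      unfolding L_def by (rule rough_laplacian_zeta[OF h e pW T linT])
    then show ?thesis
      by (simp add: metric_left[OF p] skewT[of _ "T _ (zeta p)"] sum_negf)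
  qed
  have "g p L w = 0" if w: "w \<in> hor p" for w
  proof -
    have "g p L w = (\<Sum>k = 1..DIM('e). \<Sum>j = 1..12. \<Sum>i = 1..12.
        g p (t i p (e k p) (zeta p)) (t j p (e k p) w))"
      unfolding L by (simp add: T_def metric_left[OF p] metric_right[OF p])
    also have "\<dots> = (\<Sum>j = 1..12. \<Sum>i = 1..12. mixed_term p (\<lambda>k. e k p) w (t i p) (t j p))"
      unfolding mixed_term_def by (subst sum.swap) (intro sum.cong refl sum.swap)
    also have "\<dots> = 0"
      using mixed[OF p basis w] by simp
    finally show ?thesis .
  qed
  then have "L = g p (zeta p) L *\<^sub>R zeta p"
    by (rule vertical_of_perp_hor[OF p])
  moreover have "g p (zeta p) L = nab_norm_sq e zeta p"
  proof -
    have "T (e i p) (zeta p) = - nab (e i) zeta p" if "i \<in> {1..DIM('e)}" for i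
      using xi_zeta[OF W pW se[OF that]] T[OF se[OF that] z] by simp
    then show ?thesis
      unfolding metric_sym[OF p, of "zeta p"] L nab_norm_sq_def
      by (simp add: metric_left[OF p] metric_right[OF p])
  qed
  ultimately show "rough_laplacian e zeta p = nab_norm_sq e zeta p *\<^sub>R zeta p"
    by (simp add: L_def)
qed (use zeta_smooth zeta_unit in auto)

text \<open>
  \<open>A\<close> and \<open>B\<close> are the parts of the index set of a type that lie in \<open>{5..10}\<close> and in \<open>{1..4}\<close>.
\<close>

lemma index_pairs:
  fixes i j :: nat
  assumes "(A, B) \<in> {({5, 6, 7, 8}, {1, 2}), ({9, 10}, {3, 4}),
      ({5, 6, 7, 8, 9}, {1}), ({}, {1, 2, 3, 4}), ({5, 6}, {3})}"
    and "i \<in> A" "j \<in> B"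
  shows "(i, j) \<in> {5, 6, 7, 8} \<times> {1, 2} \<union> {9, 10} \<times> {3, 4} \<union> {(9, 1), (5, 3), (6, 3)}"
  using assms by blast

lemma harmonic_reeb_of_type:
  assumes h: harmonic_structure and k: "k = 11 \<or> k = 12"
    and I: "I \<in> {{1, 2, 5, 6, 7, 8, k}, {3, 4, 9, 10, k}, {1, 5, 6, 7, 8, 9, k},
              {1, 2, 3, 4, k}, {3, 5, 6, k}}"
    and type: "structure_of_type I"
  shows "harmonic_unit_vector_field zeta"
proof -
  obtain t where t: "torsion_decomposition t"
    and t0: "\<And>j p v w. j \<in> {1..12} - I \<Longrightarrow> p \<in> topspace M \<Longrightarrow> t j p v w = 0"
    using type unfolding structure_of_type_def by blast
  have not_both: "\<not> (12 \<in> I \<and> 11 \<in> I)"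
    using I k by (elim insertE emptyE disjE) simp_all
  have parts: "(I \<inter> {5..10}, I \<inter> {1..4}) \<in> {({5, 6, 7, 8}, {1, 2}), ({9, 10}, {3, 4}),
      ({5, 6, 7, 8, 9}, {1}), ({}, {1, 2, 3, 4}), ({5, 6}, {3})}"
    using I k by (elim insertE emptyE disjE) simp_all
  show ?thesis
  proof (rule harmonic_reeb_of_mixed_term_zero[OF h t])
    fix p w i j and e :: "nat \<Rightarrow> 'e"
    assume p: "p \<in> topspace M" and e: "orthonormal_basis p e" and w: "w \<in> hor p"
      and i: "i \<in> {1..12 :: nat}" and j: "j \<in> {1..12 :: nat}"
    have ci: "torsion_class i p (t i p)" and cj: "torsion_class j p (t j p)"
      using t i j p unfolding torsion_decomposition_def by blast+
    show "mixed_term p e w (t i p) (t j p) = 0"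
    proof (cases "i \<in> I \<and> j \<in> I")
      case True
      show ?thesis
      proof (rule mixed_term_zero[OF p e w i ci j cj])
        show "\<not> (i = 12 \<and> j = 11)"
          using True not_both by blast
        show "(i, j) \<in> {5, 6, 7, 8} \<times> {1, 2} \<union> {9, 10} \<times> {3, 4} \<union> {(9, 1), (5, 3), (6, 3)}"
          if "i \<in> {5..10}" "j \<in> {1..4}"
          by (rule index_pairs[OF parts]) (use that True in auto)
      qed
    next
      case False
      then have "(\<forall>v w. t i p v w = 0) \<or> (\<forall>v w. t j p v w = 0)"
        using t0 i j p by blast
      then show ?thesis
        by (auto simp: mixed_term_def metric_left[OF p] metric_right[OF p])
    qed
  qed
qed

end

theorem proposition5p11:
  fixes M :: "'a topology" and U :: "'a \<Rightarrow> 'a set" and x :: "'a \<Rightarrow> 'a \<Rightarrow> 'e::euclidean_space"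
    and g :: "'a \<Rightarrow> 'e \<Rightarrow> 'e \<Rightarrow> real" and nab :: "('a \<Rightarrow> 'e) \<Rightarrow> ('a \<Rightarrow> 'e) \<Rightarrow> 'a \<Rightarrow> 'e"
    and n :: nat and phi :: "'a \<Rightarrow> 'e \<Rightarrow> 'e" and zeta :: "'a \<Rightarrow> 'e"
    and k :: nat and I :: "nat set"
  assumes "almost_contact_metric_manifold M U x g nab n phi zeta"
    and "almost_contact_metric_manifold.harmonic_structure M U x g nab phi zeta"
    and "k = 11 \<or> k = 12"
    and "I \<in> {{1, 2, 5, 6, 7, 8, k}, {3, 4, 9, 10, k}, {1, 5, 6, 7, 8, 9, k},
              {1, 2, 3, 4, k}, {3, 5, 6, k}}"
    and "almost_contact_metric_manifold.structure_of_type M U x g nab n phi zeta I"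
  shows "riemannian_manifold.harmonic_unit_vector_field M U x g nab zeta"
  by (rule almost_contact_metric_manifold.harmonic_reeb_of_type[OF assms])

end
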